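(* Let $f=g+h$ on $X$ satisfy the standing assumption (H) described in the context. Let $(x^n)_{n\in\mathbb N}$ be generated by the Forward-Backward algorithm $$x^0\in X,\quad \lambda\in\left]0,2L^{-1}\right[,\quad x^{n+1}=\operatorname{prox}_{\lambda g}\big(x^n-\lambda\nabla h(x^n)\big),$$ and let $\bar x\in\operatorname{argmin}f$ be its (weak) limit. Then the following hold. (i) If $f$ satisfies the finite uniform conditioning property of order $2$, then there exist $\varepsilon\in\left]0,1\right[$ and $C\in\left]0,+\infty\right[$, depending on $(\lambda,f,x^0)$, such that for all $n\ge1$, $$f(x^n)-\inf f\le\varepsilon^n\big(f(x^0)-\inf f\big)\quad\text{and}\quad\|x^{n+1}-\bar x\|\le C\sqrt{\varepsilon}^{\,n}.$$ (ii) If $f$ satisfies the finite uniform conditioning property of order $p>2$, then there exist $(C_1,C_2)\in\left]0,+\infty\right[^2$, depending on $(\lambda,f,x^0)$, such that for all $n\ge1$, $$f(x^n)-\inf f\le C_1\,n^{-\frac{p}{p-2}}\quad\text{and}\quad\|x^{n+1}-\bar x\|\le C_2\,n^{-\frac1{p-2}}.$$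
   Context: $X$ is a real separable Hilbert space with inner product $\langle\cdot,\cdot\rangle$ and norm $\|\cdot\|$; $\mathcal N\subset\mathbb N$ and $(e_k)_{k\in\mathcal N}$ is an orthonormal basis of $X$; for $x\in X$, $x_k=\langle x,e_k\rangle$. $\Gamma_0(H)$ denotes the set of proper convex lower semicontinuous functions from a Hilbert space $H$ to $\mathbb R\cup\{+\infty\}$. For an interval $I\subset\mathbb R$, $\sigma_I(t)=\sup_{s\in I}st$ is its support function. Standing assumption (H): $f=g+h$, where - $h\in\Gamma_0(X)$ is bounded from below and differentiable, and $\nabla h$ is $L$-Lipschitz continuous on $X$, $L\in\left]0,+\infty\right[$; - $g(x)=\sum_{k\in\mathcal N}g_k(x_k)$ with $g_k=\psi_k+\sigma_{I_k}$, where each $I_k$ is a proper closed interval of $\mathbb R$ ($I_k\neq\mathbb R$), there exists $\omega>0$ such that $[-\omega,\omega]\subset I_k$ for all $k\in\mathcal N$, and each $\psi_k\in\Gamma_0(\mathbb R)$ is differentiable at $0$ with $\psi_k(0)=0$ and $\psi_k'(0)=0$. $\operatorname{prox}_{\lambda g}(x)$ is the unique minimizer of $y\mapsto g(y)+\frac1{2\lambda}\|y-x\|^2$. $\operatorname{supp}(x)=\{k\in\mathcal N:x_k\ne0\}$, $X_J=\{x\in X:\operatorname{supp}(x)\subset J\}$ for $J\subset\mathcal N$, $\mathbb B_X(x,\delta)$ is the closed ball of center $x$ and radius $\delta$, and $S_\phi(r)=\{x\in X:\phi(x)-\inf\phi<r\}$. Conditioning: for $p\in[2,+\infty[$ and $\Omega\subset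 X$, $\phi\in\Gamma_0(X)$ is $p$-conditioned on $\Omega$ if there exists $\gamma>0$ such that $\frac{\gamma}{p}\operatorname{dist}(x,\operatorname{argmin}\phi)^p\le\phi(x)-\inf\phi$ for all $x\in\Omega$. $\phi\in\Gamma_0(X)$ satisfies the finite uniform conditioning property of order $p$ if, for every finite $J\subset\mathcal N$, every $\bar x\in\operatorname{argmin}\phi$ and all $(\delta,r)\in\left]0,+\infty\right[^2$, $\phi$ is $p$-conditioned on $X_J\cap\mathbb B_X(\bar x,\delta)\cap S_\phi(r)$. It is known that under (H) the Forward-Backward sequence converges weakly to a minimizer of $f$. *)

theory Defs
  imports "HOL-Analysis.Analysis"
begin

text \<open>
  Functions into the reals extended by \<open>+\<infinity>\<close> are rendered as \<^typ>\<open>ereal\<close>-valued functions;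
  membership in \<open>Gamma0\<close> excludes the value \<open>-\<infinity>\<close>.  The real Hilbert space is a type of class
  \<open>{real_inner, complete_space}\<close>; its separability follows from the existence of an orthonormal
  basis indexed by a set of natural numbers.
\<close>

section \<open>Orthonormal bases, supports, weak convergence\<close>

text \<open>Only the vectors \<open>e k\<close> with \<open>k \<in> N\<close> matter; the values of \<open>e\<close> off \<open>N\<close> are unconstrained.\<close>

definition orthonormal_basis :: "nat set \<Rightarrow> (nat \<Rightarrow> 'a::real_inner) \<Rightarrow> bool" where
  "orthonormal_basis N e \<longleftrightarrow>
     (\<forall>i\<in>N. \<forall>j\<in>N. inner (e i) (e j) = (if i = j then 1 else 0)) \<and>
     closure (span (e ` N)) = UNIV"

definition supp :: "nat set \<Rightarrow> (nat \<Rightarrow> 'a::real_inner) \<Rightarrow> 'a \<Rightarrow> nat set" where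
  "supp N e x = {k\<in>N. inner x (e k) \<noteq> 0}"

definition supported_in :: "nat set \<Rightarrow> (nat \<Rightarrow> 'a::real_inner) \<Rightarrow> nat set \<Rightarrow> 'a set" where
  "supported_in N e J = {x. supp N e x \<subseteq> J}"

definition weakly_converges_to :: "(nat \<Rightarrow> 'a::real_inner) \<Rightarrow> 'a \<Rightarrow> bool" where
  "weakly_converges_to x l \<longleftrightarrow> (\<forall>v. (\<lambda>n. inner (x n) v) \<longlonglongrightarrow> inner l v)"

section \<open>Convex functions with extended values\<close>

definition proper_fun :: "('a \<Rightarrow> ereal) \<Rightarrow> bool" where
  "proper_fun \<phi> \<longleftrightarrow> (\<forall>x. \<phi> x \<noteq> -\<infinity>) \<and> (\<exists>x. \<phi> x \<noteq> \<infinity>)"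

definition convex_fun :: "('a::real_vector \<Rightarrow> ereal) \<Rightarrow> bool" where
  "convex_fun \<phi> \<longleftrightarrow>
     (\<forall>x y. \<forall>t\<in>{0<..<1::real}.
        \<phi> ((1 - t) *\<^sub>R x + t *\<^sub>R y) \<le> ereal (1 - t) * \<phi> x + ereal t * \<phi> y)"

definition lsc_fun :: "('a::topological_space \<Rightarrow> ereal) \<Rightarrow> bool" where
  "lsc_fun \<phi> \<longleftrightarrow> (\<forall>x. \<phi> x \<le> Liminf (at x) \<phi>)"

definition Gamma0 :: "('a::real_inner \<Rightarrow> ereal) set" where
  "Gamma0 = {\<phi>. proper_fun \<phi> \<and> convex_fun \<phi> \<and> lsc_fun \<phi>}"

definition support_fun :: "real set \<Rightarrow> real \<Rightarrow> ereal" where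
  "support_fun I t = (SUP s\<in>I. ereal (s * t))"

text \<open>
  Differentiability of an extended-valued function requires finiteness near the point; this has to
  be demanded explicitly because \<open>real_of_ereal\<close> maps \<open>\<infinity>\<close> to \<open>0\<close>.
\<close>

definition ext_has_derivative_at :: "(real \<Rightarrow> ereal) \<Rightarrow> real \<Rightarrow> real \<Rightarrow> bool" where
  "ext_has_derivative_at \<psi> D t \<longleftrightarrow>
     (\<forall>\<^sub>F s in nhds t. \<bar>\<psi> s\<bar> \<noteq> \<infinity>) \<and>
     ((\<lambda>s. real_of_ereal (\<psi> s)) has_real_derivative D) (at t)"

section \<open>Minimizers, proximal operator, conditioning\<close>

definition argmin :: "('a \<Rightarrow> ereal) \<Rightarrow> 'a set" where
  "argmin \<phi> = {x. \<forall>y. \<phi> x \<le> \<phi> y}"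

text \<open>\<open>gap \<phi> x\<close> is \<open>\<phi> x - inf \<phi>\<close>; it is \<open>\<infinity>\<close> where \<open>\<phi> x = \<infinity>\<close>.\<close>

definition gap :: "('a \<Rightarrow> ereal) \<Rightarrow> 'a \<Rightarrow> ereal" where
  "gap \<phi> x = \<phi> x - (INF y. \<phi> y)"

definition prox :: "real \<Rightarrow> ('a::real_inner \<Rightarrow> ereal) \<Rightarrow> 'a \<Rightarrow> 'a" where
  "prox lam g x = (THE z. z \<in> argmin (\<lambda>y. g y + ereal (1 / (2 * lam) * (norm (y - x))\<^sup>2)))"

definition strict_sublevel :: "('a \<Rightarrow> ereal) \<Rightarrow> real \<Rightarrow> 'a set" where
  "strict_sublevel \<phi> r = {x. gap \<phi> x < ereal r}"

text \<open>
  \<open>infdist x {} = 0\<close> in the library, but the value of the distance to an empty \<open>argmin \<phi>\<close> is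
  immaterial below: \<open>finite_uniform_conditioning\<close> only uses \<open>conditioned_on\<close> in the presence of a
  minimizer.
\<close>

definition conditioned_on :: "real \<Rightarrow> ('a::real_inner \<Rightarrow> ereal) \<Rightarrow> 'a set \<Rightarrow> bool" where
  "conditioned_on p \<phi> \<Omega> \<longleftrightarrow>
     (\<exists>\<gamma>>0. \<forall>x\<in>\<Omega>. ereal (\<gamma> / p * infdist x (argmin \<phi>) powr p) \<le> gap \<phi> x)"

definition finite_uniform_conditioning ::
    "nat set \<Rightarrow> (nat \<Rightarrow> 'a::real_inner) \<Rightarrow> real \<Rightarrow> ('a \<Rightarrow> ereal) \<Rightarrow> bool" where
  "finite_uniform_conditioning N e p \<phi> \<longleftrightarrow>
     (\<forall>J. finite J \<and> J \<subseteq> N \<longrightarrow>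
       (\<forall>xbar\<in>argmin \<phi>. \<forall>\<delta>>0. \<forall>r>0.
          conditioned_on p \<phi> (supported_in N e J \<inter> cball xbar \<delta> \<inter> strict_sublevel \<phi> r)))"

end

theory Submission
  imports Defs
begin

text \<open>
  Although the space may have infinite dimension, the iterates after the first one all live in a
  single finite-dimensional coordinate subspace, and the whole proof hinges on this.  Each \<open>I k\<close> contains
  \<open>[-\<omega>, \<omega>]\<close> and \<open>\<psi> k\<close> is nonnegative, so the \<open>k\<close>-th summand of \<open>g\<close> grows at least like
  \<open>\<omega> * \<bar>t\<bar>\<close>; comparing a point with the point whose \<open>k\<close>-th coordinate is erased shows that a
  subgradient \<open>u\<close> of \<open>g\<close> at a point with nonzero \<open>k\<close>-th coordinate satisfies
  \<open>\<omega> \<le> \<bar>inner u (e k)\<bar>\<close> (\<open>separable_sum_subgradient_threshold\<close>).  The algorithm produces a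
  subgradient of \<open>g\<close> at \<open>x (Suc n)\<close>, the residual
  \<open>(1 / lam) *\<^sub>R (x n - x (Suc n)) - dh (x n)\<close>.  The residuals converge \<^emph>\<open>in norm\<close>, even though the
  iterates are only known to converge weakly (\<open>residual_converges\<close>), so only finitely many
  coordinates ever reach the threshold, uniformly in \<open>n\<close> (\<open>finite_large_coefficients_convergent\<close>,
  \<open>iterates_finite_support\<close>).  Norm convergence of the residuals comes from a sharpened Fejer
  inequality (\<open>Fejer_decrease\<close>), where cocoercivity of the gradient and \<open>lam < 2 / L\<close> make a quadratic
  form in the two quantities \<open>norm (x n - x (Suc n))\<close> and \<open>norm (dh (x n) - dh z)\<close> positive definite.

  Since the iterates are also Fejer monotone and have decreasing values, all of \<open>x (Suc n)\<close> lies in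
  one region on which the conditioning inequality is available.  Write \<open>r n\<close> for the gap of \<open>x n\<close>,
  \<open>d\<close> for the length of the step from \<open>x n\<close> to \<open>x (Suc n)\<close>, and \<open>D\<close> for the distance from
  \<open>x (Suc n)\<close> to the set of minimizers.  Three inequalities are combined, up to constants:
  \<open>r (Suc n) + d\<^sup>2 \<le> r n\<close> (\<open>sufficient_decrease\<close>), \<open>r (Suc n) \<le> d * D\<close>
  (\<open>gap_le_step_times_dist\<close>) and, by conditioning, \<open>D\<close> at most \<open>r (Suc n)\<close> to the power \<open>1 / p\<close>.
  Eliminating \<open>d\<close> and \<open>D\<close> bounds \<open>r (Suc n)\<close> to the power \<open>2 - 2 / p\<close> by a multiple of
  \<open>r n - r (Suc n)\<close>.  For \<open>p = 2\<close> this is a linear contraction, and for \<open>p > 2\<close> it forces polynomial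
  decay (\<open>polynomial_decay_if_power_recursion\<close>).

  The rates for the iterates need no summation of step lengths: Fejer monotonicity and weak lower
  semicontinuity of the norm give \<open>norm (x n - xbar) \<le> 2 * infdist (x n) (argmin f)\<close>
  (\<open>dist_weak_limit_le\<close>), and conditioning bounds the right-hand side by a power of \<open>r n\<close>.
\<close>

section \<open>Subgradients, lower semicontinuity and the proximal operator\<close>

text \<open>
  Finiteness at \<open>z\<close> is part of the definition, because the inequality alone holds for every \<open>u\<close> if
  \<open>\<phi> z = -\<infinity>\<close> and forces \<open>\<phi>\<close> to be constantly \<open>\<infinity>\<close> if \<open>\<phi> z = \<infinity>\<close>.
\<close>

definition subgradient :: "('a::real_inner \<Rightarrow> ereal) \<Rightarrow> 'a \<Rightarrow> 'a \<Rightarrow> bool" where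
  "subgradient \<phi> z u \<longleftrightarrow> \<bar>\<phi> z\<bar> \<noteq> \<infinity> \<and> (\<forall>y. \<phi> z + ereal (inner u (y - z)) \<le> \<phi> y)"

lemma convex_fun_realD:
  fixes \<phi> :: "'a::real_vector \<Rightarrow> ereal"
  assumes "convex_fun \<phi>" "\<phi> x = ereal a" "\<phi> y = ereal b" "0 < t" "t < 1"
  shows "\<phi> ((1 - t) *\<^sub>R x + t *\<^sub>R y) \<le> ereal ((1 - t) * a + t * b)"
proof -
  have "\<phi> ((1 - t) *\<^sub>R x + t *\<^sub>R y) \<le> ereal (1 - t) * \<phi> x + ereal t * \<phi> y"
    using assms(1,4,5) unfolding convex_fun_def by auto
  then show ?thesis using assms(2,3) by simp
qed

text \<open>
  A quadratic error is invisible to a convex function: applying the hypothesis at points of the segment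
  from \<open>z\<close> to \<open>y\<close> and dividing by the parameter makes the error vanish in the limit.  This
  single fact yields the optimality conditions for the proximal operator and for minimizers of
  \<open>g + h\<close>, and the gradient inequality for a smooth convex function.
\<close>

lemma subgradient_if_quadratic_minorant:
  fixes \<phi> :: "'a::real_inner \<Rightarrow> ereal"
  assumes conv: "convex_fun \<phi>" and ninf: "\<And>y. \<phi> y \<noteq> -\<infinity>" and fin: "\<bar>\<phi> z\<bar> \<noteq> \<infinity>"
    and low: "\<And>y. \<phi> z + ereal (inner u (y - z) - C * (norm (y - z))\<^sup>2) \<le> \<phi> y"
  shows "subgradient \<phi> z u"
  unfolding subgradient_def
proof (intro conjI allI fin)
  fix y
  from fin obtain a where a: "\<phi> z = ereal a" by auto
  show "\<phi> z + ereal (inner u (y - z)) \<le> \<phi> y"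
  proof (cases "\<phi> y")
    case (real b)
    let ?q = "(norm (y - z))\<^sup>2"
    have key: "inner u (y - z) - t * (C * ?q) \<le> b - a" if t: "0 < t" "t < 1" for t
    proof -
      let ?w = "(1 - t) *\<^sub>R z + t *\<^sub>R y"
      have w: "?w - z = t *\<^sub>R (y - z)" by (simp add: algebra_simps)
      have "ereal (a + (t * inner u (y - z) - C * (t\<^sup>2 * ?q))) \<le> \<phi> ?w"
        using low[of ?w] a by (simp add: w power_mult_distrib)
      also have "\<dots> \<le> ereal ((1 - t) * a + t * b)"
        by (rule convex_fun_realD[OF conv a real t])
      finally have "t * (inner u (y - z) - t * (C * ?q)) \<le> t * (b - a)"
        by (simp add: algebra_simps power2_eq_square)
      with t(1) show ?thesis by (simp only: mult_le_cancel_left_pos)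
    qed
    have lim: "((\<lambda>t. inner u (y - z) - t * (C * ?q)) \<longlongrightarrow> inner u (y - z) - 0 * (C * ?q)) (at_right 0)"
      by (intro tendsto_intros)
    have "eventually (\<lambda>t::real. t \<in> {0<..<1}) (at_right 0)"
      by (rule eventually_at_right_real) simp
    then have "eventually (\<lambda>t. inner u (y - z) - t * (C * ?q) \<le> b - a) (at_right 0)"
      by eventually_elim (use key in auto)
    with tendsto_upperbound[OF lim this] have "inner u (y - z) \<le> b - a" by simp
    then show ?thesis by (simp add: a real)
  qed (use ninf in auto)
qed

text \<open>
  Lower semicontinuity is defined with punctured neighbourhoods.  The unpunctured form is the one
  that survives composition with a continuous map, which may hit its limit value.
\<close>

lemma lsc_funD_nhds:
  assumes "lsc_fun \<phi>"
  shows "\<phi> x \<le> Liminf (nhds x) \<phi>"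
  unfolding le_Liminf_iff
proof (intro allI impI)
  fix c assume c: "c < \<phi> x"
  with assms have "eventually (\<lambda>y. c < \<phi> y) (at x)"
    unfolding lsc_fun_def le_Liminf_iff by auto
  then show "eventually (\<lambda>y. c < \<phi> y) (nhds x)"
    using c unfolding eventually_at_filter by (auto elim: eventually_mono)
qed

lemma lsc_funI_nhds:
  assumes "\<And>x. \<phi> x \<le> Liminf (nhds x) \<phi>"
  shows "lsc_fun \<phi>"
  unfolding lsc_fun_def le_Liminf_iff
proof (intro allI impI)
  fix x c assume "c < \<phi> x"
  with assms[of x] have "eventually (\<lambda>y. c < \<phi> y) (nhds x)" unfolding le_Liminf_iff by auto
  then show "eventually (\<lambda>y. c < \<phi> y) (at x)"
    unfolding eventually_at_filter by (auto elim: eventually_mono)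
qed

lemma lsc_fun_add:
  fixes \<phi> \<eta> :: "'a::t2_space \<Rightarrow> ereal"
  assumes "lsc_fun \<phi>" "lsc_fun \<eta>" "\<And>x. 0 \<le> \<phi> x" "\<And>x. 0 \<le> \<eta> x"
  shows "lsc_fun (\<lambda>x. \<phi> x + \<eta> x)"
proof (rule lsc_funI_nhds)
  fix x
  have "\<phi> x + \<eta> x \<le> Liminf (nhds x) \<phi> + Liminf (nhds x) \<eta>"
    by (intro add_mono lsc_funD_nhds assms)
  also have "\<dots> \<le> Liminf (nhds x) (\<lambda>x. \<phi> x + \<eta> x)"
    by (rule Liminf_add_le) (use assms in auto)
  finally show "\<phi> x + \<eta> x \<le> Liminf (nhds x) (\<lambda>x. \<phi> x + \<eta> x)" .
qed

lemma lsc_fun_SUP: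
  assumes "\<And>i. i \<in> A \<Longrightarrow> lsc_fun (\<phi> i)"
  shows "lsc_fun (\<lambda>x. SUP i\<in>A. \<phi> i x)"
  unfolding lsc_fun_def le_Liminf_iff
proof (intro allI impI)
  fix x c assume "c < (SUP i\<in>A. \<phi> i x)"
  then obtain i where i: "i \<in> A" "c < \<phi> i x" by (auto simp: less_SUP_iff)
  then have "eventually (\<lambda>y. c < \<phi> i y) (at x)"
    using assms[OF i(1)] unfolding lsc_fun_def le_Liminf_iff by auto
  then show "eventually (\<lambda>y. c < (SUP i\<in>A. \<phi> i y)) (at x)"
    by eventually_elim (use i in \<open>auto simp: less_SUP_iff\<close>)
qed

lemma lsc_fun_compose:
  fixes l :: "'a::t2_space \<Rightarrow> 'b::t2_space"
  assumes "lsc_fun \<phi>" "continuous_on UNIV l"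
  shows "lsc_fun (\<lambda>x. \<phi> (l x))"
proof (rule lsc_funI_nhds, unfold le_Liminf_iff, intro allI impI)
  fix x c assume "c < \<phi> (l x)"
  then have "eventually (\<lambda>y. c < \<phi> y) (nhds (l x))"
    using lsc_funD_nhds[OF assms(1), of "l x"] unfolding le_Liminf_iff by auto
  moreover have "filterlim l (nhds (l x)) (nhds x)"
    proof -
    have "isCont l x" using assms(2) by (simp add: continuous_on_eq_continuous_at)
    then show ?thesis unfolding isCont_def tendsto_at_iff_tendsto_nhds .
  qed
  ultimately show "eventually (\<lambda>y. c < \<phi> (l y)) (nhds x)"
    by (rule eventually_compose_filterlim)
qed

lemma lsc_fun_ereal_continuous:
  fixes r :: "'a::t2_space \<Rightarrow> real"
  assumes "continuous_on UNIV r"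
  shows "lsc_fun (\<lambda>x. ereal (r x))"
proof (rule lsc_fun_compose[OF _ assms], rule lsc_funI_nhds, unfold le_Liminf_iff, intro allI impI)
  fix x c assume "c < ereal x"
  moreover have "(ereal \<longlongrightarrow> ereal x) (nhds x)"
    by (intro tendsto_intros filterlim_ident)
  ultimately show "eventually (\<lambda>y. c < ereal y) (nhds x)"
    by (rule order_tendstoD(1)[rotated])
qed

text \<open>
  By the parallelogram law the quadratic term makes the objective uniformly convex: two points whose
  values are within \<open>s\<close> of the infimum have squared distance at most \<open>4 * s / c\<close>.  Hence minimizing
  sequences are Cauchy, lower semicontinuity makes the limit a minimizer, and taking \<open>s = 0\<close> gives
  uniqueness.
\<close>

lemma prox_objective_unique_minimizer:
  fixes \<phi> :: "'a::{real_inner,complete_space} \<Rightarrow> ereal"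
  assumes G: "\<phi> \<in> Gamma0" and nonneg: "\<And>y. 0 \<le> \<phi> y" and c: "0 < c"
  shows "\<exists>!z. z \<in> argmin (\<lambda>y. \<phi> y + ereal (c * (norm (y - x))\<^sup>2))" (is "\<exists>!z. z \<in> argmin ?F")
proof -
  from G have conv: "convex_fun \<phi>" and lsc: "lsc_fun \<phi>" and pr: "proper_fun \<phi>"
    by (auto simp: Gamma0_def)
  obtain y0 where y0: "\<phi> y0 \<noteq> \<infinity>" using pr unfolding proper_fun_def by auto
  have Fnn: "0 \<le> ?F y" for y using nonneg[of y] c by simp
  define m where "m = (INF y. ?F y)"
  have mle: "m \<le> ?F y" for y unfolding m_def by (rule INF_lower) simp
  have "m \<noteq> \<infinity>" using mle[of y0] y0 nonneg[of y0] by (cases "\<phi> y0") auto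
  moreover have "0 \<le> m" unfolding m_def by (rule INF_greatest) (rule Fnn)
  ultimately obtain M where M: "m = ereal M" by (cases m) auto
  have mid: "c * (norm (y - z))\<^sup>2 \<le> 4 * s" if yz: "?F y \<le> ereal (M + s)" "?F z \<le> ereal (M + s)" for y z s
  proof -
    obtain a where a: "\<phi> y = ereal a" using yz(1) nonneg[of y] by (cases "\<phi> y") auto
    obtain b where b: "\<phi> z = ereal b" using yz(2) nonneg[of z] by (cases "\<phi> z") auto
    let ?w = "(1 - 1/2) *\<^sub>R y + (1/2::real) *\<^sub>R z"
    have "m \<le> \<phi> ?w + ereal (c * (norm (?w - x))\<^sup>2)" by (rule mle)
    also have "\<dots> \<le> ereal ((1 - 1/2) * a + (1/2) * b) + ereal (c * (norm (?w - x))\<^sup>2)"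
      by (intro add_mono convex_fun_realD[OF conv a b]) auto
    finally have 1: "M \<le> a/2 + b/2 + c * (norm (?w - x))\<^sup>2" by (simp add: M)
    have par: "(norm (?w - x))\<^sup>2 = (norm (y - x))\<^sup>2 / 2 + (norm (z - x))\<^sup>2 / 2 - (norm (y - z))\<^sup>2 / 4"
    proof -
      have "?w - x = (1/2) *\<^sub>R ((y - x) + (z - x))" by (simp add: algebra_simps flip: scaleR_add_left)
      then have "(norm (?w - x))\<^sup>2 = (norm ((y - x) + (z - x)))\<^sup>2 / 4"
        by (simp add: power_divide)
      also have "\<dots> = (norm (y - x))\<^sup>2 / 2 + (norm (z - x))\<^sup>2 / 2 - (norm (y - z))\<^sup>2 / 4"
        unfolding power2_norm_eq_inner by (simp add: inner_simps inner_commute add_divide_distrib diff_divide_distrib)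
      finally show ?thesis .
    qed
    have 2: "a + c * (norm (y - x))\<^sup>2 \<le> M + s" "b + c * (norm (z - x))\<^sup>2 \<le> M + s"
      using yz by (simp_all add: a b)
    show ?thesis using 1 2 unfolding par by (simp add: algebra_simps)
  qed
  have "\<exists>y. ?F y < ereal (M + 1 / Suc n)" for n
  proof -
    have "m < ereal (M + 1 / Suc n)" by (simp add: M)
    then show ?thesis unfolding m_def by (auto simp: INF_less_iff)
  qed
  then obtain y where y: "\<And>n. ?F (y n) < ereal (M + 1 / Suc n)" by metis
  have "Cauchy y"
    unfolding Cauchy_altdef2
  proof (intro allI impI)
    fix \<epsilon> :: real assume e: "0 < \<epsilon>"
    then obtain K where K: "1 / Suc K < c * \<epsilon>\<^sup>2 / 4"
      using reals_Archimedean[of "c * \<epsilon>\<^sup>2 / 4"] c by (auto simp: inverse_eq_divide)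
    show "\<exists>K. \<forall>n\<ge>K. dist (y n) (y K) < \<epsilon>"
    proof (intro exI allI impI)
      fix n assume n: "K \<le> n"
      have "1 / real (Suc n) \<le> 1 / real (Suc K)" using n by (simp add: frac_le)
      then have "?F (y n) \<le> ereal (M + 1 / Suc K)"
        by (intro order_trans[OF less_imp_le[OF y[of n]]]) simp
      then have "c * (norm (y n - y K))\<^sup>2 \<le> 4 * (1 / Suc K)"
        using less_imp_le[OF y[of K]] by (rule mid)
      also have "\<dots> < c * \<epsilon>\<^sup>2" using K by simp
      finally have "(norm (y n - y K))\<^sup>2 < \<epsilon>\<^sup>2" using c by simp
      then show "dist (y n) (y K) < \<epsilon>" using e by (simp add: dist_norm power2_less_imp_less)
    qed
  qed
  then obtain z where z: "y \<longlonglongrightarrow> z" using Cauchy_convergent convergent_def by blast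
  have lscF: "lsc_fun ?F"
    by (intro lsc_fun_add lsc lsc_fun_ereal_continuous continuous_intros nonneg) (use c in auto)
  have "?F z \<le> m"
  proof (rule ccontr)
    assume "\<not> ?F z \<le> m"
    then obtain b where b: "m < ereal b" "ereal b < ?F z"
      using ereal_dense2[of m "?F z"] by (auto simp: not_le)
    have "eventually (\<lambda>v. ereal b < ?F v) (nhds z)"
      using lsc_funD_nhds[OF lscF, of z] b(2) unfolding le_Liminf_iff by auto
    then have 1: "eventually (\<lambda>n. ereal b < ?F (y n)) sequentially"
      using z by (rule eventually_compose_filterlim)
    have "0 < b - M" using b(1) by (simp add: M)
    then have "eventually (\<lambda>n. 1 / real (Suc n) < b - M) sequentially"
      using order_tendstoD(2)[OF LIMSEQ_Suc[OF lim_1_over_n[where 'a = real]], of "b - M"] by simp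
    with 1 have "eventually (\<lambda>n. False) sequentially"
    proof eventually_elim
      case (elim n)
      have "ereal b < ereal (M + 1 / Suc n)" using elim(1) y[of n] by (rule less_trans)
      with elim(2) show ?case by simp
    qed
    then show False by simp
  qed
  then have zmin: "z \<in> argmin ?F" unfolding argmin_def using mle order_trans by blast
  show ?thesis
  proof (rule ex1I[where P = "\<lambda>z. z \<in> argmin ?F" and a = z])
    show "z \<in> argmin ?F" by (fact zmin)
    fix v assume v: "v \<in> argmin ?F"
    have "?F v \<le> m" unfolding m_def by (rule INF_greatest) (use v in \<open>auto simp: argmin_def\<close>)
    with \<open>?F z \<le> m\<close> have "c * (norm (v - z))\<^sup>2 \<le> 4 * 0" by (intro mid) (auto simp: M)
    with c show "v = z" by (simp add: mult_le_0_iff)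
  qed
qed

text \<open>
  The optimality condition of the proximal problem.  Expanding the square around the minimizer turns
  minimality into an affine minorant up to a quadratic error.
\<close>

lemma prox_subgradient:
  fixes \<phi> :: "'a::{real_inner,complete_space} \<Rightarrow> ereal"
  assumes G: "\<phi> \<in> Gamma0" and nonneg: "\<And>y. 0 \<le> \<phi> y" and lam: "0 < lam"
  shows "subgradient \<phi> (prox lam \<phi> x) ((1 / lam) *\<^sub>R (x - prox lam \<phi> x))"
proof -
  let ?c = "1 / (2 * lam)"
  let ?F = "\<lambda>y. \<phi> y + ereal (?c * (norm (y - x))\<^sup>2)"
  from G have conv: "convex_fun \<phi>" and pr: "proper_fun \<phi>"
    by (auto simp: Gamma0_def)
  define z where "z = prox lam \<phi> x"
  have "z \<in> argmin ?F"
    unfolding z_def prox_def using prox_objective_unique_minimizer[OF G nonneg, of ?c x] lam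
    by (intro theI'[where P = "\<lambda>z. z \<in> argmin ?F"]) simp
  then have zmin: "?F z \<le> ?F y" for y by (auto simp: argmin_def)
  obtain y0 where y0: "\<phi> y0 \<noteq> \<infinity>" using pr unfolding proper_fun_def by auto
  then have fin: "\<bar>\<phi> z\<bar> \<noteq> \<infinity>"
    using zmin[of y0] nonneg[of z] by (cases "\<phi> z"; cases "\<phi> y0") auto
  have "subgradient \<phi> z ((1 / lam) *\<^sub>R (x - z))"
  proof (rule subgradient_if_quadratic_minorant[OF conv _ fin, where C = ?c])
    show "\<phi> y \<noteq> -\<infinity>" for y using nonneg[of y] by auto
    fix y
    have "?c * (norm (y - x))\<^sup>2 = ?c * (norm (z - x))\<^sup>2 
        - (inner ((1 / lam) *\<^sub>R (x - z)) (y - z) - ?c * (norm (y - z))\<^sup>2)"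
    proof -
      have "(norm (y - x))\<^sup>2 = (norm (z - x))\<^sup>2 - 2 * inner (x - z) (y - z) + (norm (y - z))\<^sup>2"
        by (simp add: power2_norm_eq_inner inner_simps inner_commute)
      then show ?thesis unfolding inner_scaleR_left using lam by (simp add: field_simps)
    qed
    then show "\<phi> z + ereal (inner ((1 / lam) *\<^sub>R (x - z)) (y - z) - ?c * (norm (y - z))\<^sup>2) \<le> \<phi> y"
      using zmin[of y] fin by (cases "\<phi> z"; cases "\<phi> y") auto
  qed
  then show ?thesis by (simp add: z_def)
qed

section \<open>Convex functions with Lipschitz gradient\<close>

text \<open>
  Along the segment from \<open>x\<close> to \<open>y\<close>, the function minus its first-order and quadratic terms has
  nonpositive derivative.
\<close>

lemma Lipschitz_gradient_quadratic_upper_bound: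
  fixes h :: "'a::real_inner \<Rightarrow> real"
  assumes grad: "\<And>u. GDERIV h u :> dh u" and lip: "L-lipschitz_on UNIV dh"
  shows "h y \<le> h x + inner (dh x) (y - x) + L / 2 * (norm (y - x))\<^sup>2"
proof -
  let ?d = "y - x"
  define r where "r t = h (x + t *\<^sub>R ?d) - t * inner (dh x) ?d - L / 2 * t\<^sup>2 * (norm ?d)\<^sup>2" for t
  have deriv: "(r has_real_derivative
      inner (dh (x + t *\<^sub>R ?d) - dh x) ?d - L * t * (norm ?d)\<^sup>2) (at t)" for t
  proof -
    have "((\<lambda>t. h (x + t *\<^sub>R ?d)) has_derivative (\<lambda>s. inner (s *\<^sub>R ?d) (dh (x + t *\<^sub>R ?d)))) (at t)"
      by (rule has_derivative_compose[where f = "\<lambda>t. x + t *\<^sub>R ?d" and g = h])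
        (use grad[of "x + t *\<^sub>R ?d"] in \<open>auto simp: gderiv_def intro!: derivative_eq_intros\<close>)
    then have "((\<lambda>t. h (x + t *\<^sub>R ?d)) has_real_derivative inner (dh (x + t *\<^sub>R ?d)) ?d) (at t)"
      by (simp add: has_field_derivative_def inner_commute mult_commute_abs)
    then show ?thesis
      unfolding r_def by (auto intro!: derivative_eq_intros simp: inner_diff_left)
  qed
  have "r 1 \<le> r 0"
  proof (rule DERIV_nonpos_imp_nonincreasing[of 0 1 r])
    fix t :: real assume t: "0 \<le> t" "t \<le> 1"
    have "inner (dh (x + t *\<^sub>R ?d) - dh x) ?d \<le> norm (dh (x + t *\<^sub>R ?d) - dh x) * norm ?d"
      by (rule norm_cauchy_schwarz)
    also have "\<dots> \<le> (L * norm (x + t *\<^sub>R ?d - x)) * norm ?d"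
      by (intro mult_right_mono lipschitz_on_normD[OF lip]) auto
    also have "\<dots> = L * t * (norm ?d)\<^sup>2" using t by (simp add: power2_eq_square)
    finally show "\<exists>m. (r has_real_derivative m) (at t) \<and> m \<le> 0"
      using deriv[of t] by (auto intro!: exI)
  qed simp
  then show ?thesis by (simp add: r_def)
qed

text \<open>
  The quadratic upper bound for \<open>- h\<close> is a quadratic lower bound for \<open>h\<close>, and convexity removes its
  quadratic error term.
\<close>

lemma convex_gradient_inequality:
  fixes h :: "'a::real_inner \<Rightarrow> real"
  assumes conv: "convex_fun (\<lambda>u. ereal (h u))"
    and grad: "\<And>u. GDERIV h u :> dh u" and lip: "L-lipschitz_on UNIV dh"
  shows "h x + inner (dh x) (y - x) \<le> h y"
proof -
  have "GDERIV (\<lambda>u. - h u) u :> - dh u" for u using grad by (rule GDERIV_minus)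
  moreover have "L-lipschitz_on UNIV (\<lambda>u. - dh u)"
    using lip by (simp add: lipschitz_on_def dist_norm norm_minus_commute)
  ultimately have "- h z \<le> - h x + inner (- dh x) (z - x) + L / 2 * (norm (z - x))\<^sup>2" for z
    by (rule Lipschitz_gradient_quadratic_upper_bound)
  then have "subgradient (\<lambda>u. ereal (h u)) x (dh x)"
    by (intro subgradient_if_quadratic_minorant[OF conv, where C = "L / 2"]) 
      (auto simp: algebra_simps)
  then show ?thesis by (simp add: subgradient_def)
qed

text \<open>
  The Baillon-Haddad theorem.  Comparing the tangent plane at \<open>x\<close> with the quadratic upper bound at
  \<open>y\<close>, both evaluated at the gradient step \<open>y - (1 / L) *\<^sub>R (dh y - dh x)\<close>, improves the gradient
  inequality by the term \<open>1 / (2 * L) * (norm (dh y - dh x))\<^sup>2\<close>; adding the two versions with \<open>x\<close> and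
  \<open>y\<close> exchanged gives the claim.
\<close>

lemma gradient_cocoercive:
  fixes h :: "'a::real_inner \<Rightarrow> real"
  assumes conv: "convex_fun (\<lambda>u. ereal (h u))"
    and grad: "\<And>u. GDERIV h u :> dh u" and lip: "L-lipschitz_on UNIV dh" and L: "0 < L"
  shows "(1 / L) * (norm (dh x - dh y))\<^sup>2 \<le> inner (dh x - dh y) (x - y)"
proof -
  have half: "h x + inner (dh x) (y - x) + 1 / (2 * L) * (norm (dh y - dh x))\<^sup>2 \<le> h y" for x y
  proof -
    let ?D = "dh y - dh x"
    let ?w = "y - (1 / L) *\<^sub>R ?D"
    have "h x + inner (dh x) (?w - x) \<le> h ?w" by (rule convex_gradient_inequality[OF conv grad lip])
    also have "\<dots> \<le> h y + inner (dh y) (?w - y) + L / 2 * (norm (?w - y))\<^sup>2"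
      by (rule Lipschitz_gradient_quadratic_upper_bound[OF grad lip])
    finally have 1: "h x + inner (dh x) (?w - x) \<le> h y + inner (dh y) (?w - y) + L / 2 * (norm (?w - y))\<^sup>2" .
    have 2: "inner (dh x) (?w - x) = inner (dh x) (y - x) - (1 / L) * inner (dh x) ?D"
      by (simp add: inner_diff_right)
    have 3: "inner (dh y) (?w - y) = - (1 / L) * inner (dh y) ?D" by (simp add: inner_diff_right)
    have 4: "L / 2 * (norm (?w - y))\<^sup>2 = 1 / (2 * L) * (norm ?D)\<^sup>2"
      using L by (simp add: power_mult_distrib power_divide power2_eq_square)
    have 5: "(1 / L) * (norm ?D)\<^sup>2 = (1 / L) * inner (dh y) ?D - (1 / L) * inner (dh x) ?D"
      by (simp add: power2_norm_eq_inner inner_diff_left diff_divide_distrib)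
    have 6: "(1 / L) * (norm ?D)\<^sup>2 = 2 * (1 / (2 * L) * (norm ?D)\<^sup>2)" by simp
    show ?thesis using 1 2 3 4 5 6 by linarith
  qed
  have "1 / L * (norm (dh x - dh y))\<^sup>2 = 2 * (1 / (2 * L) * (norm (dh x - dh y))\<^sup>2)" by simp
  moreover have "inner (dh x - dh y) (x - y) = - inner (dh x) (y - x) - inner (dh y) (x - y)"
    by (simp add: inner_diff_left inner_diff_right)
  ultimately show ?thesis
    using half[of x y] half[of y x] by (simp add: norm_minus_commute)
qed

section \<open>Separable sums and the threshold for their subgradients\<close>

lemma convex_fun_add:
  fixes \<phi> \<eta> :: "'a::real_vector \<Rightarrow> ereal"
  assumes "convex_fun \<phi>" "convex_fun \<eta>" "\<And>x. 0 \<le> \<phi> x" "\<And>x. 0 \<le> \<eta> x"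
  shows "convex_fun (\<lambda>x. \<phi> x + \<eta> x)"
  unfolding convex_fun_def
proof (intro allI ballI)
  fix x y and t :: real assume t: "t \<in> {0<..<1}"
  have "\<phi> ((1 - t) *\<^sub>R x + t *\<^sub>R y) + \<eta> ((1 - t) *\<^sub>R x + t *\<^sub>R y)
      \<le> (ereal (1 - t) * \<phi> x + ereal t * \<phi> y) + (ereal (1 - t) * \<eta> x + ereal t * \<eta> y)"
    by (intro add_mono) (use assms(1,2) t in \<open>auto simp: convex_fun_def\<close>)
  also have "\<dots> = ereal (1 - t) * (\<phi> x + \<eta> x) + ereal t * (\<phi> y + \<eta> y)"
    using t assms(3,4) by (simp add: ereal_pos_distrib ac_simps)
  finally show "\<phi> ((1 - t) *\<^sub>R x + t *\<^sub>R y) + \<eta> ((1 - t) *\<^sub>R x + t *\<^sub>R y) \<le> \<dots>" .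
qed

lemma convex_fun_SUP:
  fixes \<phi> :: "'i \<Rightarrow> 'a::real_vector \<Rightarrow> ereal"
  assumes "\<And>i. i \<in> A \<Longrightarrow> convex_fun (\<phi> i)"
  shows "convex_fun (\<lambda>x. SUP i\<in>A. \<phi> i x)"
  unfolding convex_fun_def
proof (intro allI ballI SUP_least)
  fix x y i and t :: real assume t: "t \<in> {0<..<1}" and i: "i \<in> A"
  have "\<phi> i ((1 - t) *\<^sub>R x + t *\<^sub>R y) \<le> ereal (1 - t) * \<phi> i x + ereal t * \<phi> i y"
    using assms[OF i] t unfolding convex_fun_def by blast
  also have "\<dots> \<le> ereal (1 - t) * (SUP i\<in>A. \<phi> i x) + ereal t * (SUP i\<in>A. \<phi> i y)"
    using t i by (intro add_mono ereal_mult_left_mono SUP_upper) auto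
  finally show "\<phi> i ((1 - t) *\<^sub>R x + t *\<^sub>R y) \<le> \<dots>" .
qed

lemma convex_fun_compose_inner:
  assumes "convex_fun \<phi>"
  shows "convex_fun (\<lambda>x. \<phi> (inner x v))"
  using assms unfolding convex_fun_def by (simp add: inner_add_left)

lemma Gamma0_sum:
  fixes \<phi> :: "'i \<Rightarrow> 'a::real_inner \<Rightarrow> ereal"
  assumes "finite F" "\<And>i. i \<in> F \<Longrightarrow> convex_fun (\<phi> i) \<and> lsc_fun (\<phi> i)"
    "\<And>i x. i \<in> F \<Longrightarrow> 0 \<le> \<phi> i x"
  shows "convex_fun (\<lambda>x. \<Sum>i\<in>F. \<phi> i x) \<and> lsc_fun (\<lambda>x. \<Sum>i\<in>F. \<phi> i x)"
  using assms
proof (induction F rule: finite_induct)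
  case empty
  have "lsc_fun (\<lambda>x::'a. ereal 0)" by (intro lsc_fun_ereal_continuous continuous_intros)
  then show ?case by (simp add: convex_fun_def zero_ereal_def)
next
  case (insert k F)
  then show ?case by (auto intro!: convex_fun_add lsc_fun_add sum_nonneg)
qed

text \<open>
  An infinite sum of nonnegative terms is the supremum of its finite partial sums, and convexity and
  lower semicontinuity pass to suprema.
\<close>

lemma separable_sum_Gamma0:
  fixes \<phi> :: "nat \<Rightarrow> real \<Rightarrow> ereal" and e :: "nat \<Rightarrow> 'a::real_inner"
  assumes conv: "\<And>k. k \<in> N \<Longrightarrow> convex_fun (\<phi> k)" and lsc: "\<And>k. k \<in> N \<Longrightarrow> lsc_fun (\<phi> k)"
    and nonneg: "\<And>k t. k \<in> N \<Longrightarrow> 0 \<le> \<phi> k t" and zero: "\<And>k. k \<in> N \<Longrightarrow> \<phi> k 0 = 0"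
  shows "(\<lambda>x. \<Sum>\<^sub>\<infinity>k\<in>N. \<phi> k (inner x (e k))) \<in> Gamma0"
proof -
  let ?g = "\<lambda>x. \<Sum>\<^sub>\<infinity>k\<in>N. \<phi> k (inner x (e k))"
  have SUP: "?g = (\<lambda>x. SUP F\<in>{F. finite F \<and> F \<subseteq> N}. \<Sum>k\<in>F. \<phi> k (inner x (e k)))"
    by (rule ext, rule nonneg_infsum_complete) (rule nonneg)
  have "?g 0 = 0" by (intro infsum_0) (simp add: zero)
  moreover have "0 \<le> ?g x" for x by (intro infsum_nonneg nonneg)
  then have "?g x \<noteq> -\<infinity>" for x by (metis ereal_infty_less_eq2(2) MInfty_neq_ereal(1) zero_ereal_def)
  ultimately have "proper_fun ?g" unfolding proper_fun_def by (metis PInfty_neq_ereal(1) zero_ereal_def)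
  moreover have fin: "convex_fun (\<lambda>x. \<Sum>k\<in>F. \<phi> k (inner x (e k))) \<and> lsc_fun (\<lambda>x. \<Sum>k\<in>F. \<phi> k (inner x (e k)))"
    if "finite F" "F \<subseteq> N" for F
    using that by (intro Gamma0_sum) (auto intro!: convex_fun_compose_inner[OF conv] lsc_fun_compose[OF lsc] nonneg continuous_intros)
  then have "convex_fun ?g \<and> lsc_fun ?g" unfolding SUP
    by (auto intro!: convex_fun_SUP lsc_fun_SUP)
  ultimately show ?thesis by (simp add: Gamma0_def)
qed

text \<open>
  Erasing the \<open>k\<close>-th coordinate \<open>t\<close> of \<open>z\<close> lowers the sum by exactly \<open>\<phi> k t \<ge> \<omega> * \<bar>t\<bar>\<close>, while
  the subgradient inequality allows a decrease of at most \<open>t * inner u (e k)\<close>.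
\<close>

lemma separable_sum_subgradient_threshold:
  fixes \<phi> :: "nat \<Rightarrow> real \<Rightarrow> ereal" and e :: "nat \<Rightarrow> 'a::real_inner"
  assumes ortho: "\<And>i j. i \<in> N \<Longrightarrow> j \<in> N \<Longrightarrow> inner (e i) (e j) = (if i = j then 1 else 0)"
    and growth: "\<And>k t. k \<in> N \<Longrightarrow> ereal (\<omega> * \<bar>t\<bar>) \<le> \<phi> k t" and zero: "\<And>k. k \<in> N \<Longrightarrow> \<phi> k 0 = 0"
    and omega: "0 \<le> \<omega>"
    and sub: "subgradient (\<lambda>x. \<Sum>\<^sub>\<infinity>k\<in>N. \<phi> k (inner x (e k))) z u"
    and k: "k \<in> N" "inner z (e k) \<noteq> 0"
  shows "\<omega> \<le> \<bar>inner u (e k)\<bar>"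
proof -
  let ?g = "\<lambda>x. \<Sum>\<^sub>\<infinity>k\<in>N. \<phi> k (inner x (e k))"
  have nonneg: "0 \<le> \<phi> k t" if "k \<in> N" for k t
    using growth[OF that, of t] omega by (meson abs_ge_zero ereal_less_eq(5) mult_nonneg_nonneg order_trans)
  have SUP: "?g x = (SUP F\<in>{F. finite F \<and> F \<subseteq> N}. \<Sum>k\<in>F. \<phi> k (inner x (e k)))" for x
    by (rule nonneg_infsum_complete) (rule nonneg)
  have upper: "(\<Sum>k\<in>F. \<phi> k (inner x (e k))) \<le> ?g x" if "finite F" "F \<subseteq> N" for F x
    unfolding SUP by (rule SUP_upper) (use that in auto)
  let ?t = "inner z (e k)"
  define z' where "z' = z - ?t *\<^sub>R e k"
  have z'k: "inner z' (e j) = (if j = k then 0 else inner z (e j))" if "j \<in> N" for j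
    using ortho[OF k(1) that] by (auto simp: z'_def inner_diff_left)
  obtain a where a: "?g z = ereal a" using sub unfolding subgradient_def by auto
  have "\<phi> k ?t \<le> ?g z" using upper[of "{k}" z] k by simp
  then obtain b where b: "\<phi> k ?t = ereal b" using nonneg[OF k(1), of ?t] a by (cases "\<phi> k ?t") auto
  have "?g z' \<le> ereal (a - b)"
    unfolding SUP
  proof (rule SUP_least, safe)
    fix F assume F: "finite F" "F \<subseteq> N"
    have "(\<Sum>j\<in>F. \<phi> j (inner z' (e j))) = (\<Sum>j\<in>F - {k}. \<phi> j (inner z (e j)))"
      using F zero z'k by (intro sum.mono_neutral_cong_right) (auto split: if_splits)
    moreover have "(\<Sum>j\<in>F - {k}. \<phi> j (inner z (e j))) + \<phi> k ?t = (\<Sum>j\<in>insert k F. \<phi> j (inner z (e j)))"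
      using F by (simp add: sum.insert_remove add.commute)
    moreover have "\<dots> \<le> ereal a" using upper[of "insert k F" z] F k a by simp
    ultimately have "(\<Sum>j\<in>F - {k}. \<phi> j (inner z (e j))) + ereal b \<le> ereal a"
      "(\<Sum>j\<in>F. \<phi> j (inner z' (e j))) = (\<Sum>j\<in>F - {k}. \<phi> j (inner z (e j)))"
      by (simp_all add: b)
    then show "(\<Sum>j\<in>F. \<phi> j (inner z' (e j))) \<le> ereal (a - b)"
      by (cases "\<Sum>j\<in>F - {k}. \<phi> j (inner z (e j))") auto
  qed
  moreover have "?g z + ereal (inner u (z' - z)) \<le> ?g z'"
    using sub unfolding subgradient_def by blast
  ultimately have "ereal (a + inner u (z' - z)) \<le> ereal (a - b)" using a order_trans by fastforce
  then have "b \<le> ?t * inner u (e k)" by (simp add: z'_def)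
  moreover have "\<omega> * \<bar>?t\<bar> \<le> b" using growth[OF k(1), of ?t] by (simp add: b)
  moreover have "?t * inner u (e k) \<le> \<bar>?t\<bar> * \<bar>inner u (e k)\<bar>" by (metis abs_ge_self abs_mult)
  ultimately have "\<omega> * \<bar>?t\<bar> \<le> \<bar>inner u (e k)\<bar> * \<bar>?t\<bar>" by (simp add: mult.commute)
  then show ?thesis using k(2) by simp
qed

text \<open>
  The usual argument that a critical point of a convex function is a minimizer, for a function that
  may be infinite away from \<open>0\<close>: its difference quotients from \<open>0\<close> towards \<open>t\<close> stay below \<open>\<psi> t\<close>
  and tend to \<open>0\<close>.
\<close>

lemma convex_nonneg_if_critical_zero:
  fixes \<psi> :: "real \<Rightarrow> ereal"
  assumes conv: "convex_fun \<psi>" and ninf: "\<And>t. \<psi> t \<noteq> -\<infinity>" and zero: "\<psi> 0 = 0"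
    and deriv: "ext_has_derivative_at \<psi> 0 0"
  shows "0 \<le> \<psi> t"
proof (cases "\<psi> t")
  case (real a)
  let ?P = "\<lambda>s. real_of_ereal (\<psi> s)"
  have "(?P has_real_derivative 0) (at (0 * t))" using deriv by (simp add: ext_has_derivative_at_def)
  then have "((\<lambda>s. ?P (s * t)) has_real_derivative 0 * t) (at 0)"
    by (rule DERIV_chain2) (auto intro!: derivative_eq_intros)
  then have "((\<lambda>s. ?P (s * t) / s) \<longlongrightarrow> 0) (at 0)"
    by (simp add: has_field_derivative_iff zero)
  then have lim: "((\<lambda>s. ?P (s * t) / s) \<longlongrightarrow> 0) (at_right 0)"
    by (rule filterlim_mono) (auto simp: at_within_le_at)
  have bound: "?P (s * t) / s \<le> a" if s: "0 < s" "s < 1" for s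
  proof -
    have "\<psi> ((1 - s) *\<^sub>R 0 + s *\<^sub>R t) \<le> ereal ((1 - s) * 0 + s * a)"
      by (rule convex_fun_realD[OF conv _ real s]) (simp add: zero zero_ereal_def)
    then have "?P (s * t) \<le> s * a" using ninf[of "s * t"] by (cases "\<psi> (s * t)") auto
    then show ?thesis using s(1) by (simp add: field_simps)
  qed
  have "eventually (\<lambda>s::real. s \<in> {0<..<1}) (at_right 0)"
    by (rule eventually_at_right_real) simp
  then have "eventually (\<lambda>s. ?P (s * t) / s \<le> a) (at_right 0)"
    by eventually_elim (use bound in auto)
  from tendsto_upperbound[OF lim this] show ?thesis by (simp add: real)
qed (use ninf in auto)

lemma convex_lsc_support_fun: "convex_fun (support_fun I) \<and> lsc_fun (support_fun I)"
proof -
  have eq: "support_fun I = (\<lambda>t. SUP s\<in>I. ereal (s * t))" by (rule ext) (simp add: support_fun_def)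
  show ?thesis unfolding eq
    by (intro conjI convex_fun_SUP lsc_fun_SUP lsc_fun_ereal_continuous continuous_intros)
      (simp add: convex_fun_def algebra_simps)
qed

lemma support_fun_ge_abs:
  assumes "{-\<omega>..\<omega>} \<subseteq> I" "0 \<le> \<omega>"
  shows "ereal (\<omega> * \<bar>t\<bar>) \<le> support_fun I t"
proof -
  have "ereal (\<omega> * \<bar>t\<bar>) = ereal ((if 0 \<le> t then \<omega> else -\<omega>) * t)" by simp
  also have "\<dots> \<le> support_fun I t" unfolding support_fun_def
    by (rule SUP_upper) (use assms in auto)
  finally show ?thesis .
qed

lemma support_fun_0: "I \<noteq> {} \<Longrightarrow> support_fun I 0 = 0"
  by (simp add: support_fun_def zero_ereal_def)

section \<open>Coefficients in an orthonormal family\<close>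

lemma Bessel_inequality_finite:
  fixes e :: "'i \<Rightarrow> 'a::real_inner"
  assumes ortho: "\<And>i j. i \<in> F \<Longrightarrow> j \<in> F \<Longrightarrow> inner (e i) (e j) = (if i = j then 1 else 0)"
    and "finite F"
  shows "(\<Sum>k\<in>F. (inner w (e k))\<^sup>2) \<le> (norm w)\<^sup>2"
proof -
  let ?s = "\<Sum>k\<in>F. inner w (e k) *\<^sub>R e k"
  have "inner w ?s = (\<Sum>k\<in>F. (inner w (e k))\<^sup>2)"
    by (simp add: inner_sum_right power2_eq_square)
  moreover have "inner ?s ?s = (\<Sum>k\<in>F. (inner w (e k))\<^sup>2)"
  proof -
    have "inner ?s ?s = (\<Sum>i\<in>F. inner w (e i) * (\<Sum>j\<in>F. inner w (e j) * inner (e i) (e j)))"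
      by (subst inner_sum_left) (simp add: inner_sum_right sum_distrib_left mult_ac)
    also have "\<dots> = (\<Sum>i\<in>F. inner w (e i) * inner w (e i))"
    proof (rule sum.cong[OF refl])
      fix i assume i: "i \<in> F"
      have "(\<Sum>j\<in>F. inner w (e j) * inner (e i) (e j)) = (\<Sum>j\<in>F. if i = j then inner w (e j) else 0)"
        by (rule sum.cong) (use ortho i in auto)
      then show "inner w (e i) * (\<Sum>j\<in>F. inner w (e j) * inner (e i) (e j)) = inner w (e i) * inner w (e i)"
        using i \<open>finite F\<close> by simp
    qed
    finally show ?thesis by (simp add: power2_eq_square)
  qed
  moreover have "0 \<le> inner (w - ?s) (w - ?s)" by simp
  ultimately show ?thesis
    by (simp add: inner_diff_left inner_diff_right inner_commute power2_norm_eq_inner)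
qed

lemma finite_large_coefficients:
  fixes e :: "'i \<Rightarrow> 'a::real_inner"
  assumes ortho: "\<And>i j. i \<in> N \<Longrightarrow> j \<in> N \<Longrightarrow> inner (e i) (e j) = (if i = j then 1 else 0)"
    and a: "0 < a"
  shows "finite {k\<in>N. a \<le> \<bar>inner w (e k)\<bar>}"
proof -
  obtain B :: nat where B: "(norm w)\<^sup>2 / a\<^sup>2 \<le> B" using real_arch_simple by blast
  have "card F \<le> B" if F: "F \<subseteq> {k\<in>N. a \<le> \<bar>inner w (e k)\<bar>}" "finite F" for F
  proof -
    have "real (card F) * a\<^sup>2 = (\<Sum>k\<in>F. a\<^sup>2)" by simp
    also have "\<dots> \<le> (\<Sum>k\<in>F. (inner w (e k))\<^sup>2)"
    proof (rule sum_mono)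
      fix k assume "k \<in> F"
      then have "a \<le> \<bar>inner w (e k)\<bar>" using F by auto
      then have "a\<^sup>2 \<le> \<bar>inner w (e k)\<bar>\<^sup>2" using a by (intro power_mono) auto
      then show "a\<^sup>2 \<le> (inner w (e k))\<^sup>2" by simp
    qed
    also have "\<dots> \<le> (norm w)\<^sup>2"
      by (intro Bessel_inequality_finite ortho F(2)) (use F(1) in auto)
    finally have "real (card F) \<le> (norm w)\<^sup>2 / a\<^sup>2" using a by (simp add: field_simps)
    with B show ?thesis by linarith
  qed
  then show ?thesis using finite_if_finite_subsets_card_bdd by blast
qed

text \<open>
  The terms of a norm convergent sequence form a relatively compact set, so its coefficients in an orthonormal
  family are small off a finite set of indices, uniformly in \<open>n\<close>: far along the sequence a
  coefficient above \<open>a\<close> leaves a coefficient of the limit above \<open>a / 2\<close>.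
\<close>

lemma finite_large_coefficients_convergent:
  fixes e :: "'i \<Rightarrow> 'a::real_inner"
  assumes ortho: "\<And>i j. i \<in> N \<Longrightarrow> j \<in> N \<Longrightarrow> inner (e i) (e j) = (if i = j then 1 else 0)"
    and a: "0 < a" and lim: "w \<longlonglongrightarrow> l"
  shows "finite {k\<in>N. \<exists>n. a \<le> \<bar>inner (w n) (e k)\<bar>}"
proof -
  obtain m where m: "\<And>n. m \<le> n \<Longrightarrow> norm (w n - l) < a / 2"
    using LIMSEQ_D[OF lim, of "a / 2"] a by auto
  have "{k\<in>N. \<exists>n. a \<le> \<bar>inner (w n) (e k)\<bar>} \<subseteq>
      (\<Union>n<m. {k\<in>N. a \<le> \<bar>inner (w n) (e k)\<bar>}) \<union> {k\<in>N. a / 2 \<le> \<bar>inner l (e k)\<bar>}"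
  proof safe
    fix k n assume k: "k \<in> N" and n: "a \<le> \<bar>inner (w n) (e k)\<bar>"
      and no: "k \<notin> (\<Union>n<m. {k\<in>N. a \<le> \<bar>inner (w n) (e k)\<bar>})"
    from k n no have "\<not> n < m" by blast
    then have "m \<le> n" by simp
    have "\<bar>inner (w n - l) (e k)\<bar> \<le> norm (w n - l) * norm (e k)" by (rule Cauchy_Schwarz_ineq2)
    also have "norm (e k) = 1" using ortho[OF k k] by (simp add: norm_eq_sqrt_inner)
    finally have "\<bar>inner (w n) (e k) - inner l (e k)\<bar> < a / 2"
      using m[OF \<open>m \<le> n\<close>] by (simp add: inner_diff_left)
    with n show "a / 2 \<le> \<bar>inner l (e k)\<bar>" by linarith
  qed
  moreover have "finite \<dots>"
    using a by (intro finite_UnI finite_UN_I finite_lessThan finite_large_coefficients[where e = e] ortho) auto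
  ultimately show ?thesis by (rule finite_subset)
qed

section \<open>Decay of a recursive sequence of real numbers\<close>

text \<open>
  The recursion is a discrete version of the differential inequality \<open>s' \<le> - s powr (1 + \<alpha>) / K\<close>,
  whose solutions decay like \<open>n powr (- (1 / \<alpha>))\<close>.  By induction: if \<open>s (Suc n)\<close> exceeded the
  claimed bound, the recursion would force a decrease between \<open>s n\<close> and \<open>s (Suc n)\<close> larger than what
  remains between two consecutive values of the bound, as soon as the constant \<open>C\<close> is large.
\<close>

lemma polynomial_decay_if_power_recursion:
  fixes s :: "nat \<Rightarrow> real"
  assumes nonneg: "\<And>n. 0 \<le> s n" and K: "0 < K" and \<alpha>: "0 < \<alpha>"
    and rec: "\<And>n. s (Suc n) powr (1 + \<alpha>) \<le> K * (s n - s (Suc n))"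
  shows "\<exists>C>0. \<forall>n. s n \<le> C * real (Suc n) powr (- (1 / \<alpha>))"
proof -
  define q where "q = 1 / \<alpha>"
  have q: "0 < q" "q * \<alpha> = 1" using \<alpha> by (simp_all add: q_def)
  \<comment> \<open>Two consecutive values of the bound differ by at most
    \<open>C * q * 2 powr (q + 1) * real (n + 2) powr (- q - 1)\<close>, by the mean value theorem and
    \<open>(n + 2) / 2 \<le> n + 1\<close>; comparing with the recursion,
    the induction step needs \<open>B \<le> C powr \<alpha>\<close>.\<close>
  define B where "B = K * q * 2 powr (q + 1)"
  have B: "0 < B" using K q by (simp add: B_def)
  define C where "C = max (s 0 + 1) (B powr q)"
  have C: "0 < C" "s 0 \<le> C" "B powr q \<le> C" using nonneg[of 0] by (auto simp: C_def)
  have "B = (B powr q) powr \<alpha>" using q B by (simp add: powr_powr)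
  also have "\<dots> \<le> C powr \<alpha>" using C \<alpha> by (intro powr_mono2) auto
  finally have CB: "B \<le> C powr \<alpha>" .
  have exponent: "- q * (1 + \<alpha>) = - q - 1" using q(2) by (simp add: algebra_simps)
  have "s n \<le> C * real (Suc n) powr (- q)" for n
  proof (induction n)
    case 0
    then show ?case using C by simp
  next
    case (Suc n)
    let ?a = "real (Suc n)" and ?b = "real (Suc (Suc n))"
    show ?case
    proof (rule ccontr)
      assume "\<not> ?thesis"
      then have gt: "C * ?b powr (- q) < s (Suc n)" by simp
      have "\<exists>z>?a. z < ?b \<and> ?b powr (- q) - ?a powr (- q) = (?b - ?a) * (- q * z powr (- q - 1))"
        by (rule MVT2) (auto intro!: DERIV_powr[THEN DERIV_cong] derivative_eq_intros)
      then obtain z where z: "?a < z" "z < ?b"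
        and eq: "?b powr (- q) - ?a powr (- q) = (?b - ?a) * (- q * z powr (- q - 1))" by blast
      have "z powr (- q - 1) \<le> (?b / 2) powr (- q - 1)"
        by (rule powr_mono2') (use z q in auto)
      also have "\<dots> = 2 powr (q + 1) * ?b powr (- q - 1)"
        by (simp add: powr_divide powr_minus_divide[of 2] flip: powr_minus) (simp add: powr_diff powr_minus divide_simps powr_add)
      finally have "q * z powr (- q - 1) \<le> q * (2 powr (q + 1) * ?b powr (- q - 1))"
        using q by (intro mult_left_mono) auto
      then have drop: "?a powr (- q) - ?b powr (- q) \<le> q * 2 powr (q + 1) * ?b powr (- q - 1)"
        using eq by (simp add: algebra_simps)
      have "C * (B * ?b powr (- q - 1)) \<le> C * (C powr \<alpha> * ?b powr (- q - 1))"
        using CB C by (intro mult_left_mono mult_right_mono) auto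
      also have "\<dots> = C powr (1 + \<alpha>) * ?b powr (- q * (1 + \<alpha>))"
        using C exponent by (simp add: powr_add)
      also have "\<dots> = (C * ?b powr (- q)) powr (1 + \<alpha>)"
        using C by (simp add: powr_mult powr_powr)
      also have "\<dots> < s (Suc n) powr (1 + \<alpha>)"
        using gt C \<alpha> by (intro powr_less_mono2) auto
      also have "\<dots> \<le> K * (s n - s (Suc n))" by (rule rec)
      also have "\<dots> \<le> K * (C * ?a powr (- q) - C * ?b powr (- q))"
        using K gt Suc.IH by (intro mult_left_mono) auto
      also have "\<dots> = K * C * (?a powr (- q) - ?b powr (- q))" by (simp add: algebra_simps)
      also have "\<dots> \<le> K * C * (q * 2 powr (q + 1) * ?b powr (- q - 1))"
        using K C drop by (intro mult_left_mono) auto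
      also have "\<dots> = C * (B * ?b powr (- q - 1))" by (simp add: B_def)
      finally show False by simp
    qed
  qed
  then show ?thesis using C unfolding q_def by blast
qed

section \<open>The forward-backward iteration\<close>

lemma subgradient_monotone:
  assumes "subgradient \<phi> y u" "subgradient \<phi> z v"
  shows "0 \<le> inner (u - v) (y - z)"
proof -
  obtain a b where ab: "\<phi> y = ereal a" "\<phi> z = ereal b" using assms unfolding subgradient_def by auto
  have "\<phi> y + ereal (inner u (z - y)) \<le> \<phi> z" "\<phi> z + ereal (inner v (y - z)) \<le> \<phi> y"
    using assms unfolding subgradient_def by blast+
  then have "a + inner u (z - y) \<le> b" "b + inner v (y - z) \<le> a" by (simp_all add: ab)
  then show ?thesis by (simp add: inner_diff_left inner_diff_right)
qed

lemma le_infdistI: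
  assumes "A \<noteq> {}" "\<And>a. a \<in> A \<Longrightarrow> d \<le> dist x a"
  shows "d \<le> infdist x A"
  using assms by (auto simp: infdist_notempty intro: cINF_greatest)

text \<open>
  The algorithm for an arbitrary nonnegative \<open>g\<close> in \<open>Gamma0\<close>; separability of \<open>g\<close> enters only through the
  finite support of the iterates.
\<close>

locale forward_backward =
  fixes f g :: "'a::{real_inner,complete_space} \<Rightarrow> ereal" and h :: "'a \<Rightarrow> real" and dh :: "'a \<Rightarrow> 'a"
    and L lam :: real and x :: "nat \<Rightarrow> 'a" and xbar :: 'a
  assumes f_eq: "f u = g u + ereal (h u)"
    and g_Gamma0: "g \<in> Gamma0" and g_nonneg: "0 \<le> g u"
    and h_convex: "convex_fun (\<lambda>u. ereal (h u))"
    and h_gradient: "GDERIV h u :> dh u"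
    and L_pos: "0 < L" and dh_Lipschitz: "L-lipschitz_on UNIV dh"
    and lam_pos: "0 < lam" and lam_less: "lam < 2 / L"
    and step: "x (Suc n) = prox lam g (x n - lam *\<^sub>R dh (x n))"
    and xbar_argmin: "xbar \<in> argmin f"
begin

lemmas quadratic_upper_bound = Lipschitz_gradient_quadratic_upper_bound[OF h_gradient dh_Lipschitz]
lemmas gradient_inequality = convex_gradient_inequality[OF h_convex h_gradient dh_Lipschitz]
lemmas cocoercive = gradient_cocoercive[OF h_convex h_gradient dh_Lipschitz L_pos]

lemma g_not_MInf: "g u \<noteq> -\<infinity>"
  using g_nonneg[of u] by auto

lemma step_subgradient:
  "subgradient g (x (Suc n)) ((1 / lam) *\<^sub>R (x n - x (Suc n)) - dh (x n))"
proof -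
  have "(1 / lam) *\<^sub>R (x n - lam *\<^sub>R dh (x n) - x (Suc n)) = (1 / lam) *\<^sub>R (x n - x (Suc n)) - dh (x n)"
    using lam_pos by (simp add: scaleR_right_diff_distrib)
  then show ?thesis
    using prox_subgradient[OF g_Gamma0 g_nonneg lam_pos, of "x n - lam *\<^sub>R dh (x n)"]
    by (simp flip: step)
qed

lemma g_finite_if_minimizer:
  assumes "z \<in> argmin f"
  shows "\<bar>g z\<bar> \<noteq> \<infinity>"
proof -
  obtain y where "g y \<noteq> \<infinity>" using g_Gamma0 by (auto simp: Gamma0_def proper_fun_def)
  moreover have "f z \<le> f y" using assms by (simp add: argmin_def)
  ultimately show ?thesis using g_not_MInf[of z] g_not_MInf[of y]
    by (cases "g z"; cases "g y") (auto simp: f_eq)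
qed

lemma minimizer_subgradient:
  assumes z: "z \<in> argmin f"
  shows "subgradient g z (- dh z)"
proof (rule subgradient_if_quadratic_minorant[where C = "L / 2"])
  show "convex_fun g" using g_Gamma0 by (simp add: Gamma0_def)
  show "g y \<noteq> -\<infinity>" for y by (rule g_not_MInf)
  show fin: "\<bar>g z\<bar> \<noteq> \<infinity>" using z by (rule g_finite_if_minimizer)
  fix y
  have "f z \<le> f y" using z by (simp add: argmin_def)
  then show "g z + ereal (inner (- dh z) (y - z) - L / 2 * (norm (y - z))\<^sup>2) \<le> g y"
    using fin quadratic_upper_bound[of y z] g_not_MInf[of y]
    by (cases "g z"; cases "g y") (auto simp: f_eq)
qed

lemma lam_L: "lam * L < 2"
  using lam_less L_pos by (simp add: field_simps)

text \<open>
  Monotonicity of the subdifferential, applied at \<open>x (Suc n)\<close> and \<open>z\<close>, and cocoercivity of the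
  gradient give this inequality with, in place of the multiple of \<open>c\<close>, the quadratic form
  \<open>d\<^sup>2 - 2 * lam * d * a + 2 * lam / L * a\<^sup>2\<close> in the step length \<open>d\<close> and the gradient
  difference \<open>a\<close>.  It is positive definite exactly because \<open>lam < 2 / L\<close>.
\<close>

lemma Fejer_decrease:
  "\<exists>c>0. \<forall>z\<in>argmin f. \<forall>n. (norm (x (Suc n) - z))\<^sup>2
     + c * ((norm (x n - x (Suc n)))\<^sup>2 + (norm (dh (x n) - dh z))\<^sup>2) \<le> (norm (x n - z))\<^sup>2"
proof -
  \<comment> \<open>Young's inequality with weight \<open>\<theta>\<close> splits the mixed term; any \<open>\<theta>\<close> strictly between
    \<open>lam * L / 2\<close> and \<open>1\<close> leaves both squares a positive coefficient.\<close>
  define \<theta> where "\<theta> = (1 + lam * L / 2) / 2"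
  have \<theta>: "0 < \<theta>" "lam * L / 2 < \<theta>" "\<theta> < 1"
    using lam_L mult_pos_pos[OF lam_pos L_pos] by (auto simp: \<theta>_def)
  define c where "c = min (1 - \<theta>) (2 * lam / L - lam\<^sup>2 / \<theta>)"
  have "lam\<^sup>2 / \<theta> < 2 * lam / L"
  proof -
    have "lam * (lam * L) < lam * (2 * \<theta>)" using \<theta>(2) lam_pos by (intro mult_strict_left_mono) auto
    then show ?thesis using \<theta>(1) L_pos by (simp add: field_simps power2_eq_square)
  qed
  then have c: "0 < c" using \<theta> by (simp add: c_def)
  have "(norm (x (Suc n) - z))\<^sup>2
     + c * ((norm (x n - x (Suc n)))\<^sup>2 + (norm (dh (x n) - dh z))\<^sup>2) \<le> (norm (x n - z))\<^sup>2"
    if z: "z \<in> argmin f" for z n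
  proof -
    let ?d = "x n - x (Suc n)" and ?g = "dh (x n) - dh z" and ?y = "x (Suc n) - z"
    have "0 \<le> inner ((1 / lam) *\<^sub>R ?d - dh (x n) - (- dh z)) ?y"
      by (rule subgradient_monotone[OF step_subgradient minimizer_subgradient[OF z]])
    moreover have "inner ((1 / lam) *\<^sub>R d - a - (- b)) y = 1 / lam * inner d y - inner (a - b) y"
      for d a b y :: 'a by (simp add: inner_diff_left inner_add_left)
    ultimately have "inner ?g ?y \<le> 1 / lam * inner ?d ?y" by simp
    then have "lam * inner ?g ?y \<le> lam * ((1 / lam) * inner ?d ?y)"
      using lam_pos by (intro mult_left_mono) auto
    then have 1: "lam * inner ?g ?y \<le> inner ?d ?y" using lam_pos by simp
    have 2: "(norm (x n - z))\<^sup>2 = (norm ?d)\<^sup>2 + (norm ?y)\<^sup>2 + 2 * inner ?d ?y"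
      by (simp add: power2_norm_eq_inner inner_simps inner_commute)
    have "inner ?g ?y = inner ?g (x n - z) - inner ?g ?d" by (simp add: inner_simps)
    moreover have "inner ?g ?d \<le> norm ?g * norm ?d" by (rule norm_cauchy_schwarz)
    ultimately have "1 / L * (norm ?g)\<^sup>2 - norm ?g * norm ?d \<le> inner ?g ?y"
      using cocoercive[of "x n" z] by linarith
    then have 3: "lam * (1 / L * (norm ?g)\<^sup>2 - norm ?g * norm ?d) \<le> lam * inner ?g ?y"
      using lam_pos by (intro mult_left_mono) auto
    have "0 \<le> (\<theta> * norm ?d - lam * norm ?g)\<^sup>2 / \<theta>" using \<theta> by simp
    also have "\<dots> = \<theta> * (norm ?d)\<^sup>2 - 2 * (lam * (norm ?g * norm ?d)) + lam\<^sup>2 / \<theta> * (norm ?g)\<^sup>2"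
      using \<theta>(1) by (simp add: power2_diff field_simps power2_eq_square)
    finally have 4: "2 * (lam * (norm ?g * norm ?d)) \<le> \<theta> * (norm ?d)\<^sup>2 + lam\<^sup>2 / \<theta> * (norm ?g)\<^sup>2" by simp
    have "c * (norm ?d)\<^sup>2 \<le> (1 - \<theta>) * (norm ?d)\<^sup>2" by (intro mult_right_mono) (auto simp: c_def)
    moreover have "c * (norm ?g)\<^sup>2 \<le> (2 * lam / L - lam\<^sup>2 / \<theta>) * (norm ?g)\<^sup>2"
      by (intro mult_right_mono) (auto simp: c_def)
    ultimately have 5: "c * ((norm ?d)\<^sup>2 + (norm ?g)\<^sup>2)
        \<le> (norm ?d)\<^sup>2 - \<theta> * (norm ?d)\<^sup>2 + 2 * (lam * (1 / L * (norm ?g)\<^sup>2)) - lam\<^sup>2 / \<theta> * (norm ?g)\<^sup>2"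
      by (simp add: algebra_simps)
    show ?thesis using 1 2 3 4 5 by (simp add: right_diff_distrib)
  qed
  with c show ?thesis by blast
qed

lemma dist_minimizer_antimono:
  assumes z: "z \<in> argmin f" and "m \<le> n"
  shows "norm (x n - z) \<le> norm (x m - z)"
proof -
  obtain c where c: "c > 0" "\<And>n. (norm (x (Suc n) - z))\<^sup>2
     + c * ((norm (x n - x (Suc n)))\<^sup>2 + (norm (dh (x n) - dh z))\<^sup>2) \<le> (norm (x n - z))\<^sup>2"
    using Fejer_decrease z by blast
  have "norm (x (Suc n) - z) \<le> norm (x n - z)" for n
  proof (rule power2_le_imp_le)
    have "0 \<le> c * ((norm (x n - x (Suc n)))\<^sup>2 + (norm (dh (x n) - dh z))\<^sup>2)" using c(1) by simp
    with c(2)[of n] show "(norm (x (Suc n) - z))\<^sup>2 \<le> (norm (x n - z))\<^sup>2" by linarith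
  qed simp
  then have "decseq (\<lambda>n. norm (x n - z))" by (rule decseq_SucI)
  then show ?thesis using \<open>m \<le> n\<close> by (rule decseqD)
qed

text \<open>
  The nonincreasing sequence of squared distances to \<open>xbar\<close> converges, so its decrements tend to
  \<open>0\<close>; these control both the step lengths and the gradient differences.
\<close>

lemma residual_converges:
  "(\<lambda>n. (1 / lam) *\<^sub>R (x n - x (Suc n)) - dh (x n)) \<longlonglongrightarrow> - dh xbar"
proof -
  let ?V = "\<lambda>n. (norm (x n - xbar))\<^sup>2"
  obtain c where c: "c > 0" "\<And>n. ?V (Suc n)
     + c * ((norm (x n - x (Suc n)))\<^sup>2 + (norm (dh (x n) - dh xbar))\<^sup>2) \<le> ?V n"
    using Fejer_decrease xbar_argmin by blast
  have "decseq ?V"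
    by (intro decseq_SucI power_mono dist_minimizer_antimono xbar_argmin) auto
  then obtain v where v: "?V \<longlonglongrightarrow> v" by (rule decseq_convergent[where B = 0]) auto
  have "(\<lambda>n. (?V n - ?V (Suc n)) / c) \<longlonglongrightarrow> (v - v) / c"
    by (intro tendsto_intros v LIMSEQ_Suc) (use c in auto)
  then have lim: "(\<lambda>n. (?V n - ?V (Suc n)) / c) \<longlonglongrightarrow> 0" by simp
  have bound: "(norm (x n - x (Suc n)))\<^sup>2 + (norm (dh (x n) - dh xbar))\<^sup>2 \<le> (?V n - ?V (Suc n)) / c" for n
    using c(1) c(2)[of n] by (simp add: field_simps)
  have to0: "a \<longlonglongrightarrow> 0" if "\<And>n. (norm (a n))\<^sup>2 \<le> (?V n - ?V (Suc n)) / c" for a :: "nat \<Rightarrow> 'a"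
  proof -
    have "(\<lambda>n. (norm (a n))\<^sup>2) \<longlonglongrightarrow> 0"
      by (rule tendsto_sandwich[OF _ _ tendsto_const lim]) (auto simp: that)
    then have "(\<lambda>n. sqrt ((norm (a n))\<^sup>2)) \<longlonglongrightarrow> sqrt 0" by (rule tendsto_real_sqrt)
    then show ?thesis by (simp add: tendsto_norm_zero_iff)
  qed
  have 1: "(\<lambda>n. x n - x (Suc n)) \<longlonglongrightarrow> 0"
    by (rule to0) (smt (verit) bound zero_le_power2)
  have "(\<lambda>n. dh (x n) - dh xbar) \<longlonglongrightarrow> 0"
    by (rule to0) (smt (verit) bound zero_le_power2)
  then have 2: "(\<lambda>n. dh (x n)) \<longlonglongrightarrow> dh xbar" by (simp add: LIM_zero_iff)
  have "(\<lambda>n. (1 / lam) *\<^sub>R (x n - x (Suc n)) - dh (x n)) \<longlonglongrightarrow> (1 / lam) *\<^sub>R 0 - dh xbar"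
    by (intro tendsto_intros 1 2)
  then show ?thesis by simp
qed

lemma iterates_finite_support:
  assumes ortho: "\<And>i j. i \<in> N \<Longrightarrow> j \<in> N \<Longrightarrow> inner (e i) (e j) = (if i = j then 1 else 0)"
    and omega: "0 < \<omega>"
    and threshold: "\<And>z u k. subgradient g z u \<Longrightarrow> k \<in> N \<Longrightarrow> inner z (e k) \<noteq> 0 \<Longrightarrow> \<omega> \<le> \<bar>inner u (e k)\<bar>"
  shows "\<exists>J. finite J \<and> J \<subseteq> N \<and> (\<forall>n. x (Suc n) \<in> supported_in N e J)"
proof (intro exI conjI allI)
  let ?w = "\<lambda>n. (1 / lam) *\<^sub>R (x n - x (Suc n)) - dh (x n)"
  let ?J = "{k\<in>N. \<exists>n. \<omega> \<le> \<bar>inner (?w n) (e k)\<bar>}"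
  show "finite ?J" by (rule finite_large_coefficients_convergent[OF ortho omega residual_converges])
  show "?J \<subseteq> N" by auto
  show "x (Suc n) \<in> supported_in N e ?J" for n
    unfolding supported_in_def supp_def using threshold[OF step_subgradient] by blast
qed

lemma f_xbar_finite: "\<bar>f xbar\<bar> \<noteq> \<infinity>"
  using g_finite_if_minimizer[OF xbar_argmin] by (cases "g xbar") (auto simp: f_eq)

lemma INF_f: "(INF y. f y) = f z" if "z \<in> argmin f"
  using that unfolding argmin_def by (intro antisym INF_lower INF_greatest) auto

lemma gap_eq: "gap f u = f u - f xbar"
  by (simp add: gap_def INF_f[OF xbar_argmin])

lemma gap_nonneg: "0 \<le> gap f u"
proof -
  have "f xbar \<le> f u" using xbar_argmin by (simp add: argmin_def)
  then show ?thesis using f_xbar_finite unfolding gap_eq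
    by (cases "f xbar"; cases "f u") auto
qed

text \<open>
  The subgradient inequality for \<open>g\<close> at \<open>x (Suc n)\<close>, tested at \<open>x n\<close>, plus the quadratic upper bound
  for \<open>h\<close>.  It is stated with extended values because \<open>f (x 0)\<close> may be infinite.
\<close>

lemma sufficient_decrease:
  "gap f (x (Suc n)) + ereal ((1 / lam - L / 2) * (norm (x n - x (Suc n)))\<^sup>2) \<le> gap f (x n)"
proof -
  let ?d = "x n - x (Suc n)"
  obtain a where a: "g (x (Suc n)) = ereal a" using step_subgradient[of n] unfolding subgradient_def by auto
  obtain m where m: "f xbar = ereal m" using f_xbar_finite by auto
  have sub: "g (x (Suc n)) + ereal (inner ((1 / lam) *\<^sub>R ?d - dh (x n)) ?d) \<le> g (x n)"
    using step_subgradient[of n] unfolding subgradient_def by blast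
  show ?thesis
  proof (cases "g (x n)")
    case (real b)
    have "inner ((1 / lam) *\<^sub>R ?d - dh (x n)) ?d = 1 / lam * (norm ?d)\<^sup>2 - inner (dh (x n)) ?d"
      by (simp add: inner_diff_left power2_norm_eq_inner del: scaleR_right_diff_distrib)
    moreover have "inner (dh (x n)) (x (Suc n) - x n) = - inner (dh (x n)) ?d"
      by (simp add: inner_diff_right)
    ultimately have "a + h (x (Suc n)) + (1 / lam - L / 2) * (norm ?d)\<^sup>2 \<le> b + h (x n)"
      using sub quadratic_upper_bound[of "x (Suc n)" "x n"]
      by (simp add: a real left_diff_distrib norm_minus_commute)
    then show ?thesis by (simp add: gap_eq f_eq a real m[unfolded f_eq])
  qed (use sub a m g_not_MInf in \<open>auto simp: gap_eq f_eq\<close>)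
qed

lemma gap_decseq: "decseq (\<lambda>n. gap f (x n))"
proof (rule decseq_SucI)
  fix n
  have "0 \<le> (1 / lam - L / 2) * (norm (x n - x (Suc n)))\<^sup>2"
    using lam_L lam_pos by (intro mult_nonneg_nonneg) (auto simp: field_simps)
  then have "gap f (x (Suc n)) + 0 \<le>
      gap f (x (Suc n)) + ereal ((1 / lam - L / 2) * (norm (x n - x (Suc n)))\<^sup>2)"
    by (intro add_left_mono) simp
  then show "gap f (x (Suc n)) \<le> gap f (x n)" using sufficient_decrease[of n] by simp
qed

lemma gap_finite: "gap f (x (Suc n)) \<noteq> \<infinity>"
  using step_subgradient[of n] f_xbar_finite
  by (cases "g (x (Suc n))"; cases "f xbar") (auto simp: subgradient_def gap_eq f_eq)

text \<open>
  Replacing \<open>dh (x n)\<close> by \<open>dh (x (Suc n))\<close> in the residual gives a subgradient of \<open>f\<close> at \<open>x (Suc n)\<close>, of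
  norm at most \<open>1 / lam + L\<close> times the step length; the subgradient inequality is then tested at all
  minimizers.
\<close>

lemma gap_le_step_times_dist:
  "gap f (x (Suc n)) \<le> ereal ((1 / lam + L) * norm (x n - x (Suc n)) * infdist (x (Suc n)) (argmin f))"
proof -
  let ?d = "x n - x (Suc n)" and ?y = "x (Suc n)"
  let ?c = "(1 / lam + L) * norm ?d"
  obtain r where r: "gap f ?y = ereal r" using gap_finite[of n] gap_nonneg[of ?y] by (cases "gap f ?y") auto
  obtain a where a: "g ?y = ereal a" using step_subgradient[of n] unfolding subgradient_def by auto
  have le: "r \<le> ?c * dist ?y z" if z: "z \<in> argmin f" for z
  proof -
    obtain b where b: "g z = ereal b" using g_finite_if_minimizer[OF z] by auto
    have fz: "f xbar = ereal (b + h z)" using INF_f[OF z] INF_f[OF xbar_argmin] by (simp add: f_eq b)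
    let ?v = "(1 / lam) *\<^sub>R ?d - dh (x n)"
    have "g ?y + ereal (inner ?v (z - ?y)) \<le> g z"
      using step_subgradient[of n] unfolding subgradient_def by blast
    then have 1: "a + inner ?v (z - ?y) \<le> b" by (simp add: a b)
    have 2: "h ?y + inner (dh ?y) (z - ?y) \<le> h z" by (rule gradient_inequality)
    have "r = a + h ?y - (b + h z)" using r by (simp add: gap_eq f_eq[of ?y] a fz)
    also have "\<dots> \<le> inner (?v + dh ?y) (?y - z)"
      using 1 2 by (simp add: inner_add_left inner_diff_right)
    also have "\<dots> \<le> norm (?v + dh ?y) * norm (?y - z)" by (rule norm_cauchy_schwarz)
    also have "norm (?v + dh ?y) \<le> norm ((1 / lam) *\<^sub>R ?d) + norm (dh (x n) - dh ?y)"
      using norm_triangle_ineq4[of "(1 / lam) *\<^sub>R ?d" "dh (x n) - dh ?y"] by (simp add: algebra_simps)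
    also have "norm (dh (x n) - dh ?y) \<le> L * norm ?d" by (rule lipschitz_on_normD[OF dh_Lipschitz]) auto
    also have "norm ((1 / lam) *\<^sub>R ?d) + L * norm ?d = ?c"
      using lam_pos unfolding norm_scaleR by (simp add: distrib_right)
    finally show ?thesis by (simp add: dist_norm mult_right_mono)
  qed
  show ?thesis
  proof (cases "?d = 0")
    case True
    then show ?thesis using le[OF xbar_argmin] by (simp add: r)
  next
    case False
    then have c: "0 < ?c" using lam_pos L_pos by (intro mult_pos_pos add_pos_pos) auto
    have "r / ?c \<le> infdist ?y (argmin f)"
    proof (rule le_infdistI)
      show "r / ?c \<le> dist ?y z" if "z \<in> argmin f" for z
        using le[OF that] c by (simp add: pos_divide_le_eq mult.commute)
    qed (use xbar_argmin in blast)
    then show ?thesis using c by (simp add: r pos_divide_le_eq mult.commute)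
  qed
qed

text \<open>
  Later iterates are no farther from any minimizer \<open>z\<close> than \<open>x n\<close> is, hence at distance at most
  \<open>2 * dist (x n) z\<close> from \<open>x n\<close>, and a closed ball contains its weak limits.
\<close>

lemma dist_weak_limit_le:
  assumes weak: "weakly_converges_to x xbar"
  shows "norm (x n - xbar) \<le> 2 * infdist (x n) (argmin f)"
proof -
  have le: "norm (x n - xbar) \<le> 2 * dist (x n) z" if z: "z \<in> argmin f" for z
  proof -
    let ?v = "xbar - x n"
    have "(\<lambda>m. inner (x m) ?v) \<longlonglongrightarrow> inner xbar ?v"
      using weak unfolding weakly_converges_to_def by blast
    then have "(\<lambda>m. inner (x m) ?v - inner (x n) ?v) \<longlonglongrightarrow> inner xbar ?v - inner (x n) ?v"
      by (intro tendsto_diff tendsto_const)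
    moreover have "inner (x m) ?v - inner (x n) ?v \<le> 2 * dist (x n) z * norm ?v" if "n \<le> m" for m
    proof -
      have "inner (x m) ?v - inner (x n) ?v = inner (x m - x n) ?v" by (simp add: inner_diff_left)
      also have "\<dots> \<le> norm (x m - x n) * norm ?v" by (rule norm_cauchy_schwarz)
      also have "norm (x m - x n) \<le> norm (x m - z) + norm (x n - z)"
        using norm_triangle_ineq4[of "x m - z" "x n - z"] by simp
      also have "norm (x m - z) \<le> norm (x n - z)" by (rule dist_minimizer_antimono[OF z that])
      finally show ?thesis by (simp add: dist_norm mult_right_mono)
    qed
    ultimately have "inner xbar ?v - inner (x n) ?v \<le> 2 * dist (x n) z * norm ?v"
      by (intro LIMSEQ_le_const2) auto
    then have "norm ?v * norm ?v \<le> 2 * dist (x n) z * norm ?v"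
      by (simp add: power2_norm_eq_inner flip: inner_diff_left power2_eq_square)
    then have "norm ?v \<le> 2 * dist (x n) z"
      by (cases "?v = 0") (auto simp: mult_le_cancel_right)
    then show ?thesis by (simp add: norm_minus_commute)
  qed
  have "norm (x n - xbar) / 2 \<le> infdist (x n) (argmin f)"
    using xbar_argmin le by (intro le_infdistI) (auto simp: field_simps)
  then show ?thesis by simp
qed

definition r :: "nat \<Rightarrow> real" where "r n = real_of_ereal (gap f (x n))"

lemma gap_r: "gap f (x n) \<noteq> \<infinity> \<Longrightarrow> gap f (x n) = ereal (r n)"
  using gap_nonneg[of "x n"] unfolding r_def by (cases "gap f (x n)") auto

lemma r_nonneg: "0 \<le> r n"
  using gap_nonneg[of "x n"] unfolding r_def by (cases "gap f (x n)") auto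

text \<open>
  Conditioning turns the bound on the gap by step length times distance into a bound by the step
  length alone, and sufficient decrease pays for the square of the step length.  Only \<open>n = 0\<close> can have
  an infinite gap; there \<open>r\<close> takes the default value \<open>0\<close>, for which the recursion can fail.
\<close>

lemma conditioned_estimates:
  assumes weak: "weakly_converges_to x xbar" and p: "0 < p"
    and cond: "conditioned_on p f \<Omega>" and mem: "\<And>n. x (Suc n) \<in> \<Omega>"
  obtains K M where "0 < K" "\<And>n. gap f (x n) \<noteq> \<infinity> \<Longrightarrow> r (Suc n) powr (2 - 2 / p) \<le> K * (r n - r (Suc n))"
    "0 < M" "\<And>n. norm (x (Suc n) - xbar) \<le> M * r (Suc n) powr (1 / p)"
proof -
  obtain \<gamma> where \<gamma>: "\<gamma> > 0" and
    cnd: "\<And>u. u \<in> \<Omega> \<Longrightarrow> ereal (\<gamma> / p * infdist u (argmin f) powr p) \<le> gap f u"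
    using cond unfolding conditioned_on_def by blast
  define D where "D n = infdist (x (Suc n)) (argmin f)" for n
  define B where "B = (p / \<gamma>) powr (1 / p)"
  have B: "0 < B" using \<gamma> p by (simp add: B_def)
  have D0: "0 \<le> D n" for n by (simp add: D_def infdist_nonneg)
  have D: "D n \<le> B * r (Suc n) powr (1 / p)" for n
  proof -
    have "\<gamma> / p * D n powr p \<le> r (Suc n)"
      using cnd[OF mem[of n]] gap_r[OF gap_finite[of n]] by (simp add: D_def)
    then have "D n powr p \<le> p / \<gamma> * r (Suc n)" using \<gamma> p by (simp add: field_simps)
    then have "(D n powr p) powr (1 / p) \<le> (p / \<gamma> * r (Suc n)) powr (1 / p)"
      using p by (intro powr_mono2) auto
    also have "\<dots> = B * r (Suc n) powr (1 / p)"
      unfolding B_def by (rule powr_mult)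
    finally show ?thesis using p D0[of n] by (simp add: powr_powr)
  qed
  define A where "A = (1 / lam + L) * B"
  have A: "0 < A" using lam_pos L_pos B by (simp add: A_def add_pos_pos)
  define b where "b = 1 / lam - L / 2"
  have b: "0 < b" using lam_L lam_pos by (simp add: b_def field_simps)
  have rec: "r (Suc n) powr (2 - 2 / p) \<le> A\<^sup>2 / b * (r n - r (Suc n))" if fin: "gap f (x n) \<noteq> \<infinity>" for n
  proof -
    let ?d = "norm (x n - x (Suc n))" and ?s = "r (Suc n)"
    have dec: "?s + b * ?d\<^sup>2 \<le> r n"
      using sufficient_decrease[of n] gap_r[OF gap_finite[of n]] gap_r[OF fin] by (simp add: b_def)
    have "?s \<le> (1 / lam + L) * ?d * D n"
      using gap_le_step_times_dist[of n] gap_r[OF gap_finite[of n]] by (simp add: D_def)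
    also have "\<dots> \<le> (1 / lam + L) * ?d * (B * ?s powr (1 / p))"
      using lam_pos L_pos by (intro mult_left_mono D) auto
    also have "\<dots> = A * ?d * ?s powr (1 / p)" by (simp add: A_def)
    finally have main: "?s \<le> A * ?d * ?s powr (1 / p)" .
    have "?s powr (2 - 2 / p) \<le> A\<^sup>2 * ?d\<^sup>2"
    proof (cases "?s = 0")
      case False
      then have s: "0 < ?s" using r_nonneg[of "Suc n"] by simp
      have "?s powr (1 - 1 / p) = ?s / ?s powr (1 / p)" using s by (simp add: powr_diff)
      also have "\<dots> \<le> A * ?d" using main s by (simp add: field_simps)
      finally have "(?s powr (1 - 1 / p))\<^sup>2 \<le> (A * ?d)\<^sup>2" by (intro power_mono) auto
      moreover have "(?s powr (1 - 1 / p))\<^sup>2 = ?s powr (2 - 2 / p)"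
        by (simp add: power2_eq_square flip: powr_add)
      ultimately show ?thesis by (simp add: power_mult_distrib)
    qed simp
    also have "\<dots> = A\<^sup>2 / b * (b * ?d\<^sup>2)" using b by simp
    also have "\<dots> \<le> A\<^sup>2 / b * (r n - ?s)" using dec b by (intro mult_left_mono) auto
    finally show ?thesis .
  qed
  show ?thesis
  proof (rule that[of "A\<^sup>2 / b" "2 * B"])
    fix n
    show "norm (x (Suc n) - xbar) \<le> 2 * B * r (Suc n) powr (1 / p)"
      using dist_weak_limit_le[OF weak, of "Suc n"] D[of n] by (simp add: D_def)
  qed (use A B b rec in auto)
qed

lemma iterates_in_conditioning_region:
  assumes cond: "finite_uniform_conditioning N e p f"
    and J: "finite J" "J \<subseteq> N" "\<And>n. x (Suc n) \<in> supported_in N e J"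
  shows "\<exists>\<Omega>. conditioned_on p f \<Omega> \<and> (\<forall>n. x (Suc n) \<in> \<Omega>)"
proof (intro exI conjI allI)
  let ?\<delta> = "norm (x 0 - xbar) + 1" and ?r = "r 1 + 1"
  let ?\<Omega> = "supported_in N e J \<inter> cball xbar ?\<delta> \<inter> strict_sublevel f ?r"
  have "0 < ?\<delta>" "0 < ?r" using r_nonneg[of 1] by (auto simp: add_nonneg_pos)
  then show "conditioned_on p f ?\<Omega>"
    using cond J(1,2) xbar_argmin unfolding finite_uniform_conditioning_def by blast
  fix n
  have "norm (x (Suc n) - xbar) \<le> norm (x 0 - xbar)"
    by (rule dist_minimizer_antimono[OF xbar_argmin]) simp
  moreover have "gap f (x (Suc n)) \<le> gap f (x 1)"
    using decseqD[OF gap_decseq, of 1 "Suc n"] by simp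
  then have "gap f (x (Suc n)) < ereal ?r"
    using gap_r[of 1] gap_finite[of 0] by (simp add: order_le_less_trans)
  ultimately show "x (Suc n) \<in> ?\<Omega>"
    using J(3) by (simp add: strict_sublevel_def dist_norm norm_minus_commute)
qed

text \<open>
  If \<open>gap f (x 0)\<close> is infinite, the bound on values is trivial, and the contraction only starts at
  \<open>x 1\<close>.  The bound on iterates therefore always starts from \<open>r 1\<close>.
\<close>

lemma linear_rate:
  assumes weak: "weakly_converges_to x xbar"
    and cond: "conditioned_on 2 f \<Omega>" and mem: "\<And>n. x (Suc n) \<in> \<Omega>"
  shows "\<exists>\<epsilon> C. 0 < \<epsilon> \<and> \<epsilon> < 1 \<and> 0 < C \<and>
    (\<forall>n. gap f (x n) \<le> ereal (\<epsilon> ^ n) * gap f (x 0) \<and> norm (x (n + 1) - xbar) \<le> C * sqrt \<epsilon> ^ n)"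
proof -
  obtain K M where K: "0 < K"
    "\<And>n. gap f (x n) \<noteq> \<infinity> \<Longrightarrow> r (Suc n) powr (2 - 2 / 2) \<le> K * (r n - r (Suc n))"
    and M: "0 < M" "\<And>n. norm (x (Suc n) - xbar) \<le> M * r (Suc n) powr (1 / 2)"
    using conditioned_estimates[OF weak _ cond mem] by auto
  define \<epsilon> where "\<epsilon> = K / (1 + K)"
  have \<epsilon>: "0 < \<epsilon>" "\<epsilon> < 1" using K(1) by (simp_all add: \<epsilon>_def)
  have contract: "r (Suc n) \<le> \<epsilon> * r n" if "gap f (x n) \<noteq> \<infinity>" for n
    using K(2)[OF that] K(1) r_nonneg[of "Suc n"] by (simp add: \<epsilon>_def field_simps)
  have geometric: "r (m + n) \<le> \<epsilon> ^ n * r m" if "gap f (x m) \<noteq> \<infinity>" for m n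
  proof (induction n)
    case (Suc n)
    have "gap f (x (m + n)) \<noteq> \<infinity>" using that gap_finite by (cases "m + n") auto
    then have "r (m + Suc n) \<le> \<epsilon> * r (m + n)" using contract by simp
    also have "\<dots> \<le> \<epsilon> * (\<epsilon> ^ n * r m)" using Suc \<epsilon> by (intro mult_left_mono) auto
    finally show ?case by simp
  qed simp
  define C where "C = M * sqrt (r 1) + 1"
  have C: "0 < C" using M(1) r_nonneg[of 1] by (simp add: C_def add_nonneg_pos)
  have "gap f (x n) \<le> ereal (\<epsilon> ^ n) * gap f (x 0)" for n
  proof (cases "gap f (x 0) = \<infinity>")
    case True
    then show ?thesis using \<epsilon> by simp
  next
    case False
    then have "gap f (x n) \<noteq> \<infinity>" using gap_finite by (cases n) auto
    then show ?thesis using geometric[of 0 n] False by (simp add: gap_r)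
  qed
  moreover have "norm (x (n + 1) - xbar) \<le> C * sqrt \<epsilon> ^ n" for n
  proof -
    have "norm (x (n + 1) - xbar) \<le> M * sqrt (r (Suc n))"
      using M(2)[of n] r_nonneg[of "Suc n"] by (simp add: powr_half_sqrt)
    also have "\<dots> \<le> M * sqrt (\<epsilon> ^ n * r 1)"
      using geometric[of 1 n] gap_finite[of 0] M(1) by (intro mult_left_mono) auto
    also have "\<dots> = M * sqrt (r 1) * sqrt \<epsilon> ^ n" by (simp add: real_sqrt_mult real_sqrt_power)
    also have "\<dots> \<le> C * sqrt \<epsilon> ^ n" using \<epsilon> by (intro mult_right_mono) (auto simp: C_def)
    finally show ?thesis .
  qed
  ultimately show ?thesis using \<epsilon> C by blast
qed

lemma sublinear_rate:
  assumes weak: "weakly_converges_to x xbar" and p: "2 < p"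
    and cond: "conditioned_on p f \<Omega>" and mem: "\<And>n. x (Suc n) \<in> \<Omega>"
  shows "\<exists>C1 C2. 0 < C1 \<and> 0 < C2 \<and>
    (\<forall>n\<ge>1. gap f (x n) \<le> ereal (C1 * real n powr (- (p / (p - 2)))) \<and>
       norm (x (n + 1) - xbar) \<le> C2 * real n powr (- (1 / (p - 2))))"
proof -
  obtain K M where K: "0 < K"
    "\<And>n. gap f (x n) \<noteq> \<infinity> \<Longrightarrow> r (Suc n) powr (2 - 2 / p) \<le> K * (r n - r (Suc n))"
    and M: "0 < M" "\<And>n. norm (x (Suc n) - xbar) \<le> M * r (Suc n) powr (1 / p)"
    using conditioned_estimates[OF weak _ cond mem] p by auto
  define q where "q = p / (p - 2)"
  have q: "1 / (1 - 2 / p) = q" "q * (1 / p) = 1 / (p - 2)" using p by (simp_all add: q_def field_simps)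
  have "\<exists>C>0. \<forall>n. r (Suc n) \<le> C * real (Suc n) powr (- (1 / (1 - 2 / p)))"
    by (rule polynomial_decay_if_power_recursion[where K = K])
      (use K K(2)[OF gap_finite] p r_nonneg in auto)
  then obtain C where C: "C > 0" "\<And>n. r (Suc n) \<le> C * real (Suc n) powr (- q)" unfolding q by blast
  show ?thesis
  proof (intro exI conjI allI impI)
    show "0 < C" "0 < M * C powr (1 / p)" using C(1) M(1) by auto
    fix n :: nat assume n: "1 \<le> n"
    then obtain k where k: "n = Suc k" by (cases n) auto
    show "gap f (x n) \<le> ereal (C * real n powr (- (p / (p - 2))))"
      using C(2)[of k] gap_r[OF gap_finite[of k]] unfolding k q_def by simp
    have "norm (x (n + 1) - xbar) \<le> M * r (Suc n) powr (1 / p)" using M(2)[of n] by simp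
    also have "\<dots> \<le> M * (C * real (Suc n) powr (- q)) powr (1 / p)"
      using C(2)[of n] M(1) p r_nonneg by (intro mult_left_mono powr_mono2) auto
    also have "\<dots> = M * C powr (1 / p) * real (Suc n) powr (- (q * (1 / p)))"
      using C(1) by (simp add: powr_mult powr_powr)
    also have "\<dots> \<le> M * C powr (1 / p) * real n powr (- (q * (1 / p)))"
      using C(1) M(1) n p unfolding q by (intro mult_left_mono powr_mono2') auto
    finally show "norm (x (n + 1) - xbar) \<le> M * C powr (1 / p) * real n powr (- (1 / (p - 2)))"
      unfolding q .
  qed
qed

end

section \<open>Convergence rates under finite uniform conditioning\<close>

theorem theorem4p5:
  fixes N :: "nat set"
    and e :: "nat \<Rightarrow> 'a::{real_inner, complete_space}"
    and f g :: "'a \<Rightarrow> ereal"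
    and h :: "'a \<Rightarrow> real"
    and grad_h :: "'a \<Rightarrow> 'a"
    and \<psi> :: "nat \<Rightarrow> real \<Rightarrow> ereal"
    and I :: "nat \<Rightarrow> real set"
    and L \<omega> lam :: real
    and x :: "nat \<Rightarrow> 'a"
    and xbar :: 'a
  assumes basis: "orthonormal_basis N e"
    and f_def: "\<And>u. f u = g u + ereal (h u)"
    and h_Gamma0: "(\<lambda>u. ereal (h u)) \<in> Gamma0"
    and h_bdd_below: "bdd_below (range h)"
    and h_grad: "\<And>u. GDERIV h u :> grad_h u"
    and L_pos: "0 < L"
    and grad_Lipschitz: "L-lipschitz_on UNIV grad_h"
    and g_def: "\<And>u. g u = (\<Sum>\<^sub>\<infinity>k\<in>N. \<psi> k (inner u (e k)) + support_fun (I k) (inner u (e k)))"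
    and I_interval: "\<And>k. k \<in> N \<Longrightarrow> is_interval (I k) \<and> closed (I k) \<and> I k \<noteq> UNIV"
    and omega_pos: "0 < \<omega>"
    and omega_I: "\<And>k. k \<in> N \<Longrightarrow> {- \<omega>..\<omega>} \<subseteq> I k"
    and psi_Gamma0: "\<And>k. k \<in> N \<Longrightarrow> \<psi> k \<in> Gamma0"
    and psi_zero: "\<And>k. k \<in> N \<Longrightarrow> \<psi> k 0 = 0"
    and psi_deriv: "\<And>k. k \<in> N \<Longrightarrow> ext_has_derivative_at (\<psi> k) 0 0"
    and lam: "0 < lam" "lam < 2 / L"
    and FB: "\<And>n. x (Suc n) = prox lam g (x n - lam *\<^sub>R grad_h (x n))"
    and xbar_argmin: "xbar \<in> argmin f"
    and xbar_limit: "weakly_converges_to x xbar"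
  shows
    "(finite_uniform_conditioning N e 2 f \<longrightarrow>
        (\<exists>\<epsilon> C. 0 < \<epsilon> \<and> \<epsilon> < 1 \<and> 0 < C \<and>
           (\<forall>n\<ge>1. gap f (x n) \<le> ereal (\<epsilon> ^ n) * gap f (x 0) \<and>
                  norm (x (n + 1) - xbar) \<le> C * sqrt \<epsilon> ^ n)))
     \<and>
     (\<forall>p>2. finite_uniform_conditioning N e p f \<longrightarrow>
        (\<exists>C1 C2. 0 < C1 \<and> 0 < C2 \<and>
           (\<forall>n\<ge>1. gap f (x n) \<le> ereal (C1 * real n powr (- (p / (p - 2)))) \<and>
                  norm (x (n + 1) - xbar) \<le> C2 * real n powr (- (1 / (p - 2))))))"
proof -
  have ortho: "\<And>i j. i \<in> N \<Longrightarrow> j \<in> N \<Longrightarrow> inner (e i) (e j) = (if i = j then 1 else 0)"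
    using basis by (simp add: orthonormal_basis_def)
  let ?\<phi> = "\<lambda>k t. \<psi> k t + support_fun (I k) t"
  have g_eq: "g = (\<lambda>u. \<Sum>\<^sub>\<infinity>k\<in>N. ?\<phi> k (inner u (e k)))" by (rule ext) (rule g_def)
  have psi: "convex_fun (\<psi> k)" "lsc_fun (\<psi> k)" "0 \<le> \<psi> k t" if k: "k \<in> N" for k t
    using psi_Gamma0[OF k] convex_nonneg_if_critical_zero[OF _ _ psi_zero[OF k] psi_deriv[OF k]]
    by (auto simp: Gamma0_def proper_fun_def)
  have sigma: "ereal (\<omega> * \<bar>t\<bar>) \<le> support_fun (I k) t" if "k \<in> N" for k t
    using omega_I[OF that] omega_pos by (intro support_fun_ge_abs) auto
  have sigma_nonneg: "0 \<le> support_fun (I k) t" if "k \<in> N" for k t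
    using sigma[OF that, of t] omega_pos
    by (meson abs_ge_zero ereal_less_eq(5) less_imp_le mult_nonneg_nonneg order_trans)
  have nonneg: "0 \<le> ?\<phi> k t" if "k \<in> N" for k t
    using psi(3)[OF that] sigma_nonneg[OF that] by simp
  have growth: "ereal (\<omega> * \<bar>t\<bar>) \<le> ?\<phi> k t" if "k \<in> N" for k t
    using add_mono[OF psi(3)[OF that] sigma[OF that]] by simp
  have zero: "?\<phi> k 0 = 0" if "k \<in> N" for k
  proof -
    have "0 \<in> I k" using omega_I[OF that] omega_pos by auto
    then have "support_fun (I k) 0 = 0" by (intro support_fun_0) auto
    then show ?thesis using psi_zero[OF that] by simp
  qed
  have g_Gamma0: "g \<in> Gamma0"
    unfolding g_eq using convex_lsc_support_fun psi sigma_nonneg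
    by (intro separable_sum_Gamma0 nonneg zero convex_fun_add lsc_fun_add) auto
  have g_nonneg: "0 \<le> g u" for u
    unfolding g_eq by (intro infsum_nonneg nonneg)
  have h_convex: "convex_fun (\<lambda>u. ereal (h u))" using h_Gamma0 by (simp add: Gamma0_def)
  interpret forward_backward f g h grad_h L lam x xbar
    by (intro forward_backward.intro)
      (rule f_def g_Gamma0 g_nonneg h_convex h_grad L_pos grad_Lipschitz lam FB xbar_argmin)+
  have threshold: "\<omega> \<le> \<bar>inner u (e k)\<bar>" if "subgradient g z u" "k \<in> N" "inner z (e k) \<noteq> 0" for z u k
  proof (rule separable_sum_subgradient_threshold[where \<phi> = ?\<phi> and e = e and z = z])
    show "subgradient (\<lambda>u. \<Sum>\<^sub>\<infinity>k\<in>N. ?\<phi> k (inner u (e k))) z u"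
      using that(1) unfolding g_eq .
    show "0 \<le> \<omega>" using omega_pos by (rule less_imp_le)
    show "inner (e i) (e j) = (if i = j then 1 else 0)" if "i \<in> N" "j \<in> N" for i j
      using that by (rule ortho)
    show "ereal (\<omega> * \<bar>t\<bar>) \<le> ?\<phi> k t" if "k \<in> N" for k t
      using that by (rule growth)
    show "?\<phi> k 0 = 0" if "k \<in> N" for k
      using that by (rule zero)
    show "k \<in> N" "inner z (e k) \<noteq> 0" by (fact that)+
  qed
  have "\<exists>J. finite J \<and> J \<subseteq> N \<and> (\<forall>n. x (Suc n) \<in> supported_in N e J)"
    by (rule iterates_finite_support[where \<omega> = \<omega>]) (fact ortho omega_pos threshold)+
  then obtain J where J: "finite J" "J \<subseteq> N" "\<And>n. x (Suc n) \<in> supported_in N e J"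
    by (elim exE conjE) simp
  show ?thesis
  proof (intro conjI allI impI)
    assume cond: "finite_uniform_conditioning N e 2 f"
    obtain \<Omega> where "conditioned_on 2 f \<Omega>" "\<And>n. x (Suc n) \<in> \<Omega>"
      using iterates_in_conditioning_region[OF cond J] by (elim exE conjE) simp
    from linear_rate[OF xbar_limit this]
    show "\<exists>\<epsilon> C. 0 < \<epsilon> \<and> \<epsilon> < 1 \<and> 0 < C \<and> (\<forall>n\<ge>1. gap f (x n) \<le> ereal (\<epsilon> ^ n) * gap f (x 0) \<and>
        norm (x (n + 1) - xbar) \<le> C * sqrt \<epsilon> ^ n)" by blast
  next
    fix p :: real assume p: "2 < p" and cond: "finite_uniform_conditioning N e p f"
    obtain \<Omega> where "conditioned_on p f \<Omega>" "\<And>n. x (Suc n) \<in> \<Omega>"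
      using iterates_in_conditioning_region[OF cond J] by (elim exE conjE) simp
    from sublinear_rate[OF xbar_limit p this]
    show "\<exists>C1 C2. 0 < C1 \<and> 0 < C2 \<and> (\<forall>n\<ge>1. gap f (x n) \<le> ereal (C1 * real n powr (- (p / (p - 2)))) \<and>
        norm (x (n + 1) - xbar) \<le> C2 * real n powr (- (1 / (p - 2))))" .
  qed
qed

end
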